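(* Let $k$ be an algebraically closed field of characteristic zero, $\mathfrak{g}$ a finite-dimensional simple Lie algebra over $k$ with a fixed Cartan subalgebra $\mathfrak{h}$, $S$ a commutative, associative, unital $k$-algebra of finite type, and let $\widetilde{\mathcal{L}}=(\mathfrak{g}\otimes_k S)\oplus\langle S,S\rangle$ be the universal central extension of $\mathcal{L}=\mathfrak{g}\otimes_k S$. If $V$ is a simple weight module for $\widetilde{\mathcal{L}}$, then every central element $\langle r,s\rangle$ ($r,s\in S$) of $\widetilde{\mathcal{L}}$ acts trivially (as zero) on $V$.
   Context: The Lie bracket on $\mathcal{L}=\mathfrak{g}\otimes S$ is $[x\otimes r,y\otimes s]=[x,y]\otimes rs$. Let $\langle S,S\rangle=(S\otimes S)/Q$, where $Q$ is the subspace spanned by $\{r\otimes s+s\otimes r,\ rs\otimes t+st\otimes r+tr\otimes s\mid r,s,t\in S\}$, and let $\langle r,s\rangle$ be the coset $r\otimes s+Q$. The universal central extension of $\mathcal{L}$ is identified with $\widetilde{\mathcal{L}}=(\mathfrak{g}\otimes S)\oplus\langle S,S\rangle$ with bracket $[x\otimes a+\langle r,s\rangle,\,y\otimes b+\langle u,v\rangle]=[x,y]\otimes ab+(x|y)\langle a,b\rangle$, where $(x|y)$ is the Killing form of $\mathfrak{g}$. An $\widetilde{\mathcal{L}}$-module $V$ is a weight module if $V=\bigoplus_{\lambda\in\mathfrak{h}^*}V_\lambda$ with each weight space $V_\lambda=\{v\in V\mid (h\otimes 1)v=\lambda(h)v\text{ for all }h\in\mathfrak{h}\}$ finite dimensional.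 *)

theory Defs
  imports "HOL-Library.Poly_Mapping" "HOL-Library.FuncSet" "HOL-Computational_Algebra.Polynomial"
begin

section \<open>Lie algebras\<close>

definition linear_trace :: "('k::field \<Rightarrow> 'v::ab_group_add \<Rightarrow> 'v) \<Rightarrow> ('v \<Rightarrow> 'v) \<Rightarrow> 'k" where
  "linear_trace scale f =
    (let B = vector_space.extend_basis scale {} in
       \<Sum>b\<in>B. module.representation scale B (f b) b)"

locale lie_algebra = vector_space scale
  for scale :: "'k::field \<Rightarrow> 'g::ab_group_add \<Rightarrow> 'g" +
  fixes br :: "'g \<Rightarrow> 'g \<Rightarrow> 'g"
  assumes br_add_left: "br (x + y) z = br x z + br y z"
    and br_add_right: "br x (y + z) = br x y + br x z"
    and br_scale_left: "br (scale c x) y = scale c (br x y)"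
    and br_scale_right: "br x (scale c y) = scale c (br x y)"
    and br_self: "br x x = 0"
    and jacobi: "br x (br y z) + br y (br z x) + br z (br x y) = 0"
begin

definition lie_ideal :: "'g set \<Rightarrow> bool" where
  "lie_ideal I \<longleftrightarrow> subspace I \<and> (\<forall>x. \<forall>y\<in>I. br x y \<in> I)"

definition lie_subalgebra :: "'g set \<Rightarrow> bool" where
  "lie_subalgebra H \<longleftrightarrow> subspace H \<and> (\<forall>x\<in>H. \<forall>y\<in>H. br x y \<in> H)"

fun lower_central :: "'g set \<Rightarrow> nat \<Rightarrow> 'g set" where
  "lower_central H 0 = H"
| "lower_central H (Suc n) = span {br x y |x y. x \<in> H \<and> y \<in> lower_central H n}"

definition normalizer :: "'g set \<Rightarrow> 'g set" where
  "normalizer H = {x. \<forall>y\<in>H. br x y \<in> H}"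

text \<open>A Cartan subalgebra is a nilpotent subalgebra that is its own normalizer.\<close>
definition cartan_subalgebra :: "'g set \<Rightarrow> bool" where
  "cartan_subalgebra H \<longleftrightarrow>
     lie_subalgebra H \<and> (\<exists>n. lower_central H n = {0}) \<and> normalizer H = H"

definition killing :: "'g \<Rightarrow> 'g \<Rightarrow> 'k" where
  "killing x y = linear_trace scale (\<lambda>z. br x (br y z))"

end

locale simple_lie_algebra = lie_algebra +
  assumes nonabelian: "\<exists>x y. br x y \<noteq> 0"
    and ideals_trivial: "lie_ideal I \<Longrightarrow> I = {0} \<or> I = UNIV"

locale fin_dim_simple_lie_algebra = simple_lie_algebra +
  assumes fin_dim: "\<exists>B. finite B \<and> span B = UNIV"


section \<open>Commutative algebras\<close>

text \<open>
  The sort \<open>{comm_ring, comm_monoid_mult}\<close> is that of commutative unital rings without the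
  requirement \<open>0 \<noteq> 1\<close> of \<open>comm_ring_1\<close>, so that the zero algebra is allowed.
\<close>
locale comm_algebra = vector_space scale
  for scale :: "'k::field \<Rightarrow> 's::{comm_ring, comm_monoid_mult} \<Rightarrow> 's" +
  assumes scale_mult_left: "scale c r * s = scale c (r * s)"
begin

definition subalgebra :: "'s set \<Rightarrow> bool" where
  "subalgebra A \<longleftrightarrow> subspace A \<and> 1 \<in> A \<and> (\<forall>r\<in>A. \<forall>s\<in>A. r * s \<in> A)"

end

locale fin_type_comm_algebra = comm_algebra +
  assumes fin_type: "\<exists>G. finite G \<and> (\<forall>A. subalgebra A \<and> G \<subseteq> A \<longrightarrow> A = UNIV)"


section \<open>Quotients and tensor products of vector spaces\<close>

text \<open>
  The quotient by a subspace has to be a vector space on a set of cosets, because a type of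
  cosets cannot depend on the scalar multiplications.  Vector spaces on an explicit carrier
  are therefore bundled in a record.
\<close>
record ('k, 'v) vspace =
  carr :: "'v set"
  vzero :: 'v
  vadd :: "'v \<Rightarrow> 'v \<Rightarrow> 'v"
  vscale :: "'k \<Rightarrow> 'v \<Rightarrow> 'v"

definition vsubspace :: "('k, 'v) vspace \<Rightarrow> 'v set \<Rightarrow> bool" where
  "vsubspace V U \<longleftrightarrow> U \<subseteq> carr V \<and> vzero V \<in> U \<and>
     (\<forall>u\<in>U. \<forall>w\<in>U. vadd V u w \<in> U) \<and> (\<forall>c. \<forall>u\<in>U. vscale V c u \<in> U)"

definition vspan :: "('k, 'v) vspace \<Rightarrow> 'v set \<Rightarrow> 'v set" where
  "vspan V G = \<Inter>{U. vsubspace V U \<and> G \<subseteq> U}"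

definition vcoset :: "('k, 'v) vspace \<Rightarrow> 'v set \<Rightarrow> 'v \<Rightarrow> 'v set" where
  "vcoset V W v = {vadd V v w |w. w \<in> W}"

text \<open>In \<open>vscale\<close> the summand \<open>w\<close> matters only for \<open>c = 0\<close>.\<close>
definition vquot :: "('k, 'v) vspace \<Rightarrow> 'v set \<Rightarrow> ('k, 'v set) vspace" where
  "vquot V W =
    \<lparr>carr = vcoset V W ` carr V,
     vzero = W,
     vadd = (\<lambda>A B. {vadd V a b |a b. a \<in> A \<and> b \<in> B}),
     vscale = (\<lambda>c A. {vadd V (vscale V c a) w |a w. a \<in> A \<and> w \<in> W})\<rparr>"

definition vdsum :: "('k, 'v) vspace \<Rightarrow> ('k, 'w) vspace \<Rightarrow> ('k, 'v \<times> 'w) vspace" where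
  "vdsum V W =
    \<lparr>carr = carr V \<times> carr W,
     vzero = (vzero V, vzero W),
     vadd = (\<lambda>p q. (vadd V (fst p) (fst q), vadd W (snd p) (snd q))),
     vscale = (\<lambda>c p. (vscale V c (fst p), vscale W c (snd p)))\<rparr>"

abbreviation free_scale :: "'k::field \<Rightarrow> ('i \<Rightarrow>\<^sub>0 'k) \<Rightarrow> ('i \<Rightarrow>\<^sub>0 'k)" where
  "free_scale c \<equiv> Poly_Mapping.map ((*) c)"

text \<open>
  The free vector space on a type of symbols; \<open>Poly_Mapping.single i 1\<close> is the basis vector
  belonging to \<open>i\<close>.
\<close>
definition free_vspace :: "('k::field, 'i \<Rightarrow>\<^sub>0 'k) vspace" where
  "free_vspace = \<lparr>carr = UNIV, vzero = 0, vadd = (+), vscale = free_scale\<rparr>"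

abbreviation free_gen :: "'a \<Rightarrow> 'b \<Rightarrow> ('a \<times> 'b) \<Rightarrow>\<^sub>0 'k::field" where
  "free_gen a b \<equiv> Poly_Mapping.single (a, b) 1"

definition bilinear_relations ::
  "('k::field \<Rightarrow> 'a::ab_group_add \<Rightarrow> 'a) \<Rightarrow> ('k \<Rightarrow> 'b::ab_group_add \<Rightarrow> 'b) \<Rightarrow> (('a \<times> 'b) \<Rightarrow>\<^sub>0 'k) set" where
  "bilinear_relations sA sB =
     {free_gen (a + a') b - free_gen a b - free_gen a' b |a a' b. True} \<union>
     {free_gen a (b + b') - free_gen a b - free_gen a b' |a b b'. True} \<union>
     {free_gen (sA c a) b - Poly_Mapping.single (a, b) c |c a b. True} \<union>
     {free_gen a (sB c b) - Poly_Mapping.single (a, b) c |c a b. True}"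

definition tensor_kernel ::
  "('k::field \<Rightarrow> 'a::ab_group_add \<Rightarrow> 'a) \<Rightarrow> ('k \<Rightarrow> 'b::ab_group_add \<Rightarrow> 'b) \<Rightarrow> (('a \<times> 'b) \<Rightarrow>\<^sub>0 'k) set" where
  "tensor_kernel sA sB = vspan free_vspace (bilinear_relations sA sB)"

definition tensor_space ::
  "('k::field \<Rightarrow> 'a::ab_group_add \<Rightarrow> 'a) \<Rightarrow> ('k \<Rightarrow> 'b::ab_group_add \<Rightarrow> 'b)
    \<Rightarrow> ('k, (('a \<times> 'b) \<Rightarrow>\<^sub>0 'k) set) vspace" where
  "tensor_space sA sB = vquot free_vspace (tensor_kernel sA sB)"

definition tensor_class ::
  "('k::field \<Rightarrow> 'a::ab_group_add \<Rightarrow> 'a) \<Rightarrow> ('k \<Rightarrow> 'b::ab_group_add \<Rightarrow> 'b)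
    \<Rightarrow> (('a \<times> 'b) \<Rightarrow>\<^sub>0 'k) \<Rightarrow> (('a \<times> 'b) \<Rightarrow>\<^sub>0 'k) set" where
  "tensor_class sA sB p = vcoset free_vspace (tensor_kernel sA sB) p"

definition tensor ::
  "('k::field \<Rightarrow> 'a::ab_group_add \<Rightarrow> 'a) \<Rightarrow> ('k \<Rightarrow> 'b::ab_group_add \<Rightarrow> 'b)
    \<Rightarrow> 'a \<Rightarrow> 'b \<Rightarrow> (('a \<times> 'b) \<Rightarrow>\<^sub>0 'k) set" where
  "tensor sA sB a b = tensor_class sA sB (free_gen a b)"


section \<open>The space of symbols \<open>\<langle>r, s\<rangle>\<close>\<close>

definition cyclic_relations ::
  "('k::field \<Rightarrow> 's::{comm_ring, comm_monoid_mult} \<Rightarrow> 's) \<Rightarrow> (('s \<times> 's) \<Rightarrow>\<^sub>0 'k) set set" where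
  "cyclic_relations sS =
     (let T = tensor_space sS sS; t = tensor sS sS in
       {vadd T (t r s) (t s r) |r s. True} \<union>
       {vadd T (vadd T (t (r * s) u) (t (s * u) r)) (t (u * r) s) |r s u. True})"

definition central_kernel ::
  "('k::field \<Rightarrow> 's::{comm_ring, comm_monoid_mult} \<Rightarrow> 's) \<Rightarrow> (('s \<times> 's) \<Rightarrow>\<^sub>0 'k) set set" where
  "central_kernel sS = vspan (tensor_space sS sS) (cyclic_relations sS)"

definition central_space ::
  "('k::field \<Rightarrow> 's::{comm_ring, comm_monoid_mult} \<Rightarrow> 's) \<Rightarrow> ('k, (('s \<times> 's) \<Rightarrow>\<^sub>0 'k) set set) vspace" where
  "central_space sS = vquot (tensor_space sS sS) (central_kernel sS)"

definition central_class ::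
  "('k::field \<Rightarrow> 's::{comm_ring, comm_monoid_mult} \<Rightarrow> 's)
    \<Rightarrow> (('s \<times> 's) \<Rightarrow>\<^sub>0 'k) set \<Rightarrow> (('s \<times> 's) \<Rightarrow>\<^sub>0 'k) set set" where
  "central_class sS A = vcoset (tensor_space sS sS) (central_kernel sS) A"

definition central_symbol ::
  "('k::field \<Rightarrow> 's::{comm_ring, comm_monoid_mult} \<Rightarrow> 's) \<Rightarrow> 's \<Rightarrow> 's \<Rightarrow> (('s \<times> 's) \<Rightarrow>\<^sub>0 'k) set set" where
  "central_symbol sS r s = central_class sS (tensor sS sS r s)"


section \<open>The universal central extension\<close>

type_synonym ('k, 'g, 's) uce = "(('g \<times> 's) \<Rightarrow>\<^sub>0 'k) set \<times> (('s \<times> 's) \<Rightarrow>\<^sub>0 'k) set set"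

definition uce_space ::
  "('k::field \<Rightarrow> 'g::ab_group_add \<Rightarrow> 'g) \<Rightarrow> ('k \<Rightarrow> 's::{comm_ring, comm_monoid_mult} \<Rightarrow> 's)
    \<Rightarrow> ('k, ('k, 'g, 's) uce) vspace" where
  "uce_space sg sS = vdsum (tensor_space sg sS) (central_space sS)"

definition bilinear_ext ::
  "('i \<Rightarrow> 'j \<Rightarrow> ('l \<Rightarrow>\<^sub>0 'k::field)) \<Rightarrow> ('i \<Rightarrow>\<^sub>0 'k) \<Rightarrow> ('j \<Rightarrow>\<^sub>0 'k) \<Rightarrow> ('l \<Rightarrow>\<^sub>0 'k)" where
  "bilinear_ext f p q =
     (\<Sum>i\<in>Poly_Mapping.keys p. \<Sum>j\<in>Poly_Mapping.keys q.
        free_scale (Poly_Mapping.lookup p i * Poly_Mapping.lookup q j) (f i j))"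

text \<open>
  The bracket is defined on representatives in the free vector space on \<open>'g \<times> 's\<close>.  The unions
  are over equal sets, since the class does not depend on the representatives; see
  \<open>uce_bracket_generators\<close> and \<open>uce_bracket_linear\<close> below.
\<close>
definition uce_bracket ::
  "('k::field \<Rightarrow> 'g::ab_group_add \<Rightarrow> 'g) \<Rightarrow> ('g \<Rightarrow> 'g \<Rightarrow> 'g)
    \<Rightarrow> ('k \<Rightarrow> 's::{comm_ring, comm_monoid_mult} \<Rightarrow> 's)
    \<Rightarrow> ('k, 'g, 's) uce \<Rightarrow> ('k, 'g, 's) uce \<Rightarrow> ('k, 'g, 's) uce" where
  "uce_bracket sg br sS X Y =
     (\<Union>p\<in>fst X. \<Union>q\<in>fst Y.
        tensor_class sg sS (bilinear_ext (\<lambda>(x, a) (y, b). free_gen (br x y) (a * b)) p q),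
      \<Union>p\<in>fst X. \<Union>q\<in>fst Y.
        central_class sS (tensor_class sS sS
          (bilinear_ext (\<lambda>(x, a) (y, b).
             Poly_Mapping.single (a, b) (lie_algebra.killing sg br x y)) p q)))"


subsection \<open>The bracket is well defined and bilinear\<close>

lemma lookup_free_scale [simp]: "Poly_Mapping.lookup (free_scale c p) i = c * Poly_Mapping.lookup p i"
  by (simp add: Poly_Mapping.map.rep_eq when_def)

lemma vector_space_free_scale: "vector_space (free_scale :: 'k::field \<Rightarrow> ('i \<Rightarrow>\<^sub>0 'k) \<Rightarrow> _)"
  by standard (auto intro!: poly_mapping_eqI simp: lookup_add algebra_simps)

interpretation free: vector_space "free_scale :: 'k::field \<Rightarrow> ('i \<Rightarrow>\<^sub>0 'k) \<Rightarrow> _"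
  by (rule vector_space_free_scale)

lemma vsubspace_free: "vsubspace free_vspace U \<longleftrightarrow> free.subspace U"
  by (auto simp: vsubspace_def free_vspace_def free.subspace_def)

lemma vspan_free: "vspan free_vspace G = free.span G"
  unfolding vspan_def vsubspace_free
  using free.span_minimal[of G] free.span_superset[of G] free.subspace_span[of G] by blast

lemma subspace_tensor_kernel: "free.subspace (tensor_kernel sA sB)"
  by (simp add: tensor_kernel_def vspan_free)

lemma tensor_class_eq: "tensor_class sA sB p = {p + w |w. w \<in> tensor_kernel sA sB}"
  by (simp add: tensor_class_def vcoset_def free_vspace_def)

lemma mem_tensor_class: "q \<in> tensor_class sA sB p \<longleftrightarrow> q - p \<in> tensor_kernel sA sB"
  unfolding tensor_class_eq by (auto intro: exI[of _ "q - p"])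

lemma tensor_class_eqI:
  assumes "p - q \<in> tensor_kernel sA sB"
  shows "tensor_class sA sB p = tensor_class sA sB q"
proof -
  note S = subspace_tensor_kernel[of sA sB]
  have "r - p \<in> tensor_kernel sA sB \<longleftrightarrow> r - q \<in> tensor_kernel sA sB" for r
    using free.subspace_add[OF S _ assms, of "r - p"] free.subspace_diff[OF S _ assms, of "r - q"]
    by auto
  then show ?thesis by (auto simp: mem_tensor_class)
qed

lemma bilinear_ext_superset:
  assumes "finite I" "finite J" "Poly_Mapping.keys p \<subseteq> I" "Poly_Mapping.keys q \<subseteq> J"
  shows "bilinear_ext f p q =
    (\<Sum>i\<in>I. \<Sum>j\<in>J. free_scale (Poly_Mapping.lookup p i * Poly_Mapping.lookup q j) (f i j))"
proof -
  have "(\<Sum>j\<in>Poly_Mapping.keys q. free_scale (Poly_Mapping.lookup p i * Poly_Mapping.lookup q j) (f i j))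
      = (\<Sum>j\<in>J. free_scale (Poly_Mapping.lookup p i * Poly_Mapping.lookup q j) (f i j))" for i
    using assms by (intro sum.mono_neutral_left) (auto simp: in_keys_iff)
  then show ?thesis
    unfolding bilinear_ext_def using assms
    by (simp, intro sum.mono_neutral_left) (auto simp: in_keys_iff)
qed

lemma bilinear_ext_add_left: "bilinear_ext f (p + p') q = bilinear_ext f p q + bilinear_ext f p' q"
proof -
  let ?I = "Poly_Mapping.keys p \<union> Poly_Mapping.keys p'"
  have "Poly_Mapping.keys (p + p') \<subseteq> ?I" by (rule keys_add)
  then show ?thesis
    using bilinear_ext_superset[of ?I "Poly_Mapping.keys q" _ q f]
    by (simp add: lookup_add free.scale_left_distrib distrib_right sum.distrib)
qed

lemma bilinear_ext_scale_left: "bilinear_ext f (free_scale c p) q = free_scale c (bilinear_ext f p q)"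
proof -
  have "Poly_Mapping.keys (free_scale c p) \<subseteq> Poly_Mapping.keys p" by (auto simp: in_keys_iff)
  then show ?thesis
    using bilinear_ext_superset[of "Poly_Mapping.keys p" "Poly_Mapping.keys q" _ q f]
    by (simp add: free.scale_sum_right mult.assoc)
qed

lemma bilinear_ext_swap: "bilinear_ext f p q = bilinear_ext (\<lambda>i j. f j i) q p"
  unfolding bilinear_ext_def by (subst sum.swap) (simp add: mult.commute)

lemma bilinear_ext_add_right: "bilinear_ext f p (q + q') = bilinear_ext f p q + bilinear_ext f p q'"
  using bilinear_ext_add_left bilinear_ext_swap by metis

lemma bilinear_ext_scale_right: "bilinear_ext f p (free_scale c q) = free_scale c (bilinear_ext f p q)"
  using bilinear_ext_scale_left bilinear_ext_swap by metis

lemma bilinear_ext_diff_left: "bilinear_ext f (p - p') q = bilinear_ext f p q - bilinear_ext f p' q"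
  using bilinear_ext_add_left[of f "p - p'" p' q] by simp

lemma bilinear_ext_diff_right: "bilinear_ext f p (q - q') = bilinear_ext f p q - bilinear_ext f p q'"
  using bilinear_ext_add_right[of f p "q - q'" q'] by simp

lemma bilinear_ext_single [simp]:
  "bilinear_ext f (Poly_Mapping.single i c) (Poly_Mapping.single j d) = free_scale (c * d) (f i j)"
  by (subst bilinear_ext_superset[where I = "{i}" and J = "{j}"]) auto

lemma bilinear_ext_kernel_left:
  assumes K: "free.subspace K"
    and rel: "\<And>g j. g \<in> bilinear_relations sA sB \<Longrightarrow> bilinear_ext f g (Poly_Mapping.single j 1) \<in> K"
    and p: "p \<in> tensor_kernel sA sB"
  shows "bilinear_ext f p q \<in> K"
proof -
  have gen: "bilinear_ext f g q \<in> K" if g: "g \<in> bilinear_relations sA sB" for g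
  proof -
    have "bilinear_ext f g q = (\<Sum>j\<in>Poly_Mapping.keys q.
        free_scale (Poly_Mapping.lookup q j) (bilinear_ext f g (Poly_Mapping.single j 1)))"
    proof -
      have "bilinear_ext f g (Poly_Mapping.single j 1)
          = (\<Sum>i\<in>Poly_Mapping.keys g. free_scale (Poly_Mapping.lookup g i) (f i j))" for j
        by (subst bilinear_ext_superset[where I = "Poly_Mapping.keys g" and J = "{j}"]) auto
      then show ?thesis
        unfolding bilinear_ext_def
        by (subst sum.swap) (simp add: free.scale_sum_right mult.commute)
    qed
    then show ?thesis
      using rel[OF g] K by (auto intro!: free.subspace_sum free.subspace_scale)
  qed
  have "free.subspace {p. bilinear_ext f p q \<in> K}"
    unfolding free.subspace_def
    using K free.subspace_0[OF K] free.subspace_add[OF K] free.subspace_scale[OF K]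
    by (auto simp: bilinear_ext_add_left bilinear_ext_scale_left) (simp add: bilinear_ext_def)
  then have "free.span (bilinear_relations sA sB) \<subseteq> {p. bilinear_ext f p q \<in> K}"
    using gen by (intro free.span_minimal) auto
  then show ?thesis using p by (auto simp: tensor_kernel_def vspan_free)
qed

lemma relation_in_kernel:
  "g \<in> bilinear_relations sA sB \<Longrightarrow> g \<in> tensor_kernel sA sB"
  by (simp add: tensor_kernel_def vspan_free free.span_base)

lemma kernel_intros:
  "free_gen (a + a') b - free_gen a b - free_gen a' b \<in> tensor_kernel sA sB"
  "free_gen a (b + b') - free_gen a b - free_gen a b' \<in> tensor_kernel sA sB"
  "free_gen (sA c a) b - Poly_Mapping.single (a, b) c \<in> tensor_kernel sA sB"
  "free_gen a (sB c b) - Poly_Mapping.single (a, b) c \<in> tensor_kernel sA sB"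
  by (rule relation_in_kernel; unfold bilinear_relations_def; blast)+

lemma free_scale_single [simp]: "free_scale c (Poly_Mapping.single i d) = Poly_Mapping.single i (c * d)"
  by (rule poly_mapping_eqI) (simp add: lookup_single when_def)

lemma free_scale_diff: "free_scale c (p - q) = free_scale c p - free_scale c q"
  by (rule free.scale_right_diff_distrib)

lemma relations_cases:
  assumes "g \<in> bilinear_relations sA sB"
  obtains (1) a a' b where "g = free_gen (a + a') b - free_gen a b - free_gen a' b"
  | (2) a b b' where "g = free_gen a (b + b') - free_gen a b - free_gen a b'"
  | (3) a b c where "g = free_gen (sA c a) b - Poly_Mapping.single (a, b) c"
  | (4) a b c where "g = free_gen a (sB c b) - Poly_Mapping.single (a, b) c"
  using assms unfolding bilinear_relations_def by blast

context vector_space begin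
lemma linear_trace_add: "linear_trace scale (\<lambda>z. f z + g z) = linear_trace scale f + linear_trace scale g"
  and linear_trace_scale: "linear_trace scale (\<lambda>z. scale c (f z)) = c * linear_trace scale f"
proof -
  have i: "independent (extend_basis {})" and s: "span (extend_basis {}) = UNIV"
    by (simp_all add: independent_extend_basis independent_empty span_extend_basis)
  show "linear_trace scale (\<lambda>z. f z + g z) = linear_trace scale f + linear_trace scale g"
    unfolding linear_trace_def Let_def
    by (simp add: representation_add[OF i] s sum.distrib)
  show "linear_trace scale (\<lambda>z. scale c (f z)) = c * linear_trace scale f"
    unfolding linear_trace_def Let_def
    by (simp add: representation_scale[OF i] s sum_distrib_left)
qed
end

context lie_algebra begin
lemma killing_add_left: "killing (x + x') y = killing x y + killing x' y"
  and killing_add_right: "killing x (y + y') = killing x y + killing x y'"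
  and killing_scale_left: "killing (scale c x) y = c * killing x y"
  and killing_scale_right: "killing x (scale c y) = c * killing x y"
  by (simp_all add: killing_def br_add_left br_add_right br_scale_left br_scale_right
      linear_trace_add linear_trace_scale)
end

lemma (in comm_algebra) scale_mult_right: "r * scale c s = scale c (r * s)"
  using scale_mult_left[of c s r] by (simp add: mult.commute)

lemma bilinear_ext_class_cong:
  assumes h: "\<And>g j. g \<in> bilinear_relations sA sB \<Longrightarrow>
      bilinear_ext h g (Poly_Mapping.single j 1) \<in> tensor_kernel sC sD"
    "\<And>g j. g \<in> bilinear_relations sA sB \<Longrightarrow>
      bilinear_ext (\<lambda>i j. h j i) g (Poly_Mapping.single j 1) \<in> tensor_kernel sC sD"
    and pq: "p' \<in> tensor_class sA sB p" "q' \<in> tensor_class sA sB q"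
  shows "tensor_class sC sD (bilinear_ext h p' q') = tensor_class sC sD (bilinear_ext h p q)"
proof (rule tensor_class_eqI)
  note S = subspace_tensor_kernel[of sC sD]
  have "bilinear_ext h (p' - p) q' \<in> tensor_kernel sC sD"
    using bilinear_ext_kernel_left[OF S h(1)] pq(1) by (simp add: mem_tensor_class)
  moreover have "bilinear_ext (\<lambda>i j. h j i) (q' - q) p \<in> tensor_kernel sC sD"
    using bilinear_ext_kernel_left[OF S h(2)] pq(2) by (simp add: mem_tensor_class)
  then have "bilinear_ext h p (q' - q) \<in> tensor_kernel sC sD"
    by (subst bilinear_ext_swap)
  ultimately have "bilinear_ext h (p' - p) q' + bilinear_ext h p (q' - q) \<in> tensor_kernel sC sD"
    by (rule free.subspace_add[OF S])
  then show "bilinear_ext h p' q' - bilinear_ext h p q \<in> tensor_kernel sC sD"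
    by (simp add: bilinear_ext_diff_left bilinear_ext_diff_right)
qed

lemma (in lie_algebra) uce_bracket_class:
  fixes sS :: "'k \<Rightarrow> 's::{comm_ring, comm_monoid_mult} \<Rightarrow> 's"
  assumes "comm_algebra sS"
  shows "uce_bracket scale br sS (tensor_class scale sS p, Z) (tensor_class scale sS q, Z') =
    (tensor_class scale sS (bilinear_ext (\<lambda>(x, a) (y, b). free_gen (br x y) (a * b)) p q),
     central_class sS (tensor_class sS sS (bilinear_ext (\<lambda>(x, a) (y, b).
       Poly_Mapping.single (a, b) (killing x y)) p q)))"
proof -
  interpret S: comm_algebra sS by fact
  let ?f = "\<lambda>(x, a) (y, b). free_gen (br x y) (a * b)"
  let ?k = "\<lambda>(x, a) (y, b). Poly_Mapping.single (a, b) (killing x y)"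
  have f: "bilinear_ext ?f g (Poly_Mapping.single j 1) \<in> tensor_kernel scale sS"
      "bilinear_ext (\<lambda>i j. ?f j i) g (Poly_Mapping.single j 1) \<in> tensor_kernel scale sS"
    if "g \<in> bilinear_relations scale sS" for g j
    using that
    by (cases rule: relations_cases; cases j;
        simp add: bilinear_ext_diff_left br_add_left br_add_right br_scale_left br_scale_right
          distrib_left distrib_right S.scale_mult_left S.scale_mult_right kernel_intros)+
  note SK = subspace_tensor_kernel[of sS sS]
  have r: "Poly_Mapping.single (a + a', b) c - Poly_Mapping.single (a, b) c - Poly_Mapping.single (a', b) c
        \<in> tensor_kernel sS sS"
      "Poly_Mapping.single (a, b + b') c - Poly_Mapping.single (a, b) c - Poly_Mapping.single (a, b') c
        \<in> tensor_kernel sS sS"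
      "Poly_Mapping.single (sS d a, b) c - Poly_Mapping.single (a, b) (d * c) \<in> tensor_kernel sS sS"
      "Poly_Mapping.single (a, sS d b) c - Poly_Mapping.single (a, b) (d * c) \<in> tensor_kernel sS sS"
    for a a' b b' c d
    using kernel_intros[THEN free.subspace_scale[OF SK, where c = c]]
    unfolding mult.commute[of d c] by (simp_all add: free_scale_diff)
  have k: "bilinear_ext ?k g (Poly_Mapping.single j 1) \<in> tensor_kernel sS sS"
      "bilinear_ext (\<lambda>i j. ?k j i) g (Poly_Mapping.single j 1) \<in> tensor_kernel sS sS"
    if "g \<in> bilinear_relations scale sS" for g j
    using that free.subspace_0[OF SK]
    by (cases rule: relations_cases; cases j;
        simp add: bilinear_ext_diff_left killing_add_left killing_add_right killing_scale_left
          killing_scale_right single_add distrib_left distrib_right S.scale_mult_left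
          S.scale_mult_right r)+
  have mem: "p \<in> tensor_class scale sS p" "q \<in> tensor_class scale sS q"
    using free.subspace_0[OF subspace_tensor_kernel] by (auto simp: mem_tensor_class)
  have f': "tensor_class scale sS (bilinear_ext ?f p' q') = tensor_class scale sS (bilinear_ext ?f p q)"
    and k': "tensor_class sS sS (bilinear_ext ?k p' q') = tensor_class sS sS (bilinear_ext ?k p q)"
    if "p' \<in> tensor_class scale sS p" "q' \<in> tensor_class scale sS q" for p' q'
    using bilinear_ext_class_cong[OF f that] bilinear_ext_class_cong[OF k that] by blast+
  have 1: "(\<Union>p'\<in>P. \<Union>q'\<in>Q. F p' q') = C"
    if "p \<in> P" "q \<in> Q" "\<And>p' q'. p' \<in> P \<Longrightarrow> q' \<in> Q \<Longrightarrow> F p' q' = C"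
    for P Q C and F :: "_ \<Rightarrow> _ \<Rightarrow> (('g \<times> 's) \<Rightarrow>\<^sub>0 'k) set"
    using that by blast
  have 2: "(\<Union>p'\<in>P. \<Union>q'\<in>Q. F p' q') = C"
    if "p \<in> P" "q \<in> Q" "\<And>p' q'. p' \<in> P \<Longrightarrow> q' \<in> Q \<Longrightarrow> F p' q' = C"
    for P Q C and F :: "_ \<Rightarrow> _ \<Rightarrow> (('s \<times> 's) \<Rightarrow>\<^sub>0 'k) set set"
    using that by blast
  show ?thesis
    unfolding uce_bracket_def fst_conv
    by (intro arg_cong2[where f = Pair] 1[OF mem] 2[OF mem]) (simp_all only: f' k')
qed


locale vspace_on =
  fixes V :: "('k::field, 'v) vspace"
  assumes zero_mem: "vzero V \<in> carr V"
    and add_mem: "\<lbrakk>u \<in> carr V; v \<in> carr V\<rbrakk> \<Longrightarrow> vadd V u v \<in> carr V"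
    and scale_mem: "u \<in> carr V \<Longrightarrow> vscale V c u \<in> carr V"
    and add_assoc: "\<lbrakk>u \<in> carr V; v \<in> carr V; w \<in> carr V\<rbrakk> \<Longrightarrow>
          vadd V (vadd V u v) w = vadd V u (vadd V v w)"
    and add_comm: "\<lbrakk>u \<in> carr V; v \<in> carr V\<rbrakk> \<Longrightarrow> vadd V u v = vadd V v u"
    and add_zero: "u \<in> carr V \<Longrightarrow> vadd V u (vzero V) = u"
    and scale_add: "\<lbrakk>u \<in> carr V; v \<in> carr V\<rbrakk> \<Longrightarrow>
          vscale V c (vadd V u v) = vadd V (vscale V c u) (vscale V c v)"
    and add_scale: "u \<in> carr V \<Longrightarrow> vscale V (c + d) u = vadd V (vscale V c u) (vscale V d u)"
    and scale_scale: "u \<in> carr V \<Longrightarrow> vscale V c (vscale V d u) = vscale V (c * d) u"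
    and scale_one: "u \<in> carr V \<Longrightarrow> vscale V 1 u = u"
    and scale_zero: "u \<in> carr V \<Longrightarrow> vscale V 0 u = vzero V"
begin

lemma add_left_comm:
  "\<lbrakk>u \<in> carr V; v \<in> carr V; w \<in> carr V\<rbrakk> \<Longrightarrow> vadd V u (vadd V v w) = vadd V v (vadd V u w)"
  using add_assoc add_comm by metis

lemmas ac = add_assoc add_comm add_left_comm

lemma vsubspace_vspan:
  assumes "G \<subseteq> carr V"
  shows "vsubspace V (vspan V G)" "G \<subseteq> vspan V G"
proof -
  have "vsubspace V (carr V)"
    by (auto simp: vsubspace_def zero_mem add_mem scale_mem)
  with assms show "vsubspace V (vspan V G)" "G \<subseteq> vspan V G"
    unfolding vspan_def vsubspace_def by blast+
qed

context
  fixes W assumes W: "vsubspace V W"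
begin

lemma W_mem: "w \<in> W \<Longrightarrow> w \<in> carr V" "vzero V \<in> W"
    "\<lbrakk>w \<in> W; w' \<in> W\<rbrakk> \<Longrightarrow> vadd V w w' \<in> W" "w \<in> W \<Longrightarrow> vscale V c w \<in> W"
  using W by (auto simp: vsubspace_def)

lemma vadd_vcoset:
  assumes "u \<in> carr V" "v \<in> carr V"
  shows "vadd (vquot V W) (vcoset V W u) (vcoset V W v) = vcoset V W (vadd V u v)"
proof (intro equalityI subsetI)
  fix z assume "z \<in> vadd (vquot V W) (vcoset V W u) (vcoset V W v)"
  then obtain w w' where w: "w \<in> W" "w' \<in> W" "z = vadd V (vadd V u w) (vadd V v w')"
    by (auto simp: vquot_def vcoset_def)
  then have "z = vadd V (vadd V u v) (vadd V w w')"
    using assms W_mem(1) by (simp add: ac add_mem)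
  with w show "z \<in> vcoset V W (vadd V u v)" unfolding vcoset_def using W_mem(3) by blast
next
  fix z assume "z \<in> vcoset V W (vadd V u v)"
  then obtain w where w: "w \<in> W" "z = vadd V (vadd V u v) w" by (auto simp: vcoset_def)
  then have "z = vadd V (vadd V u w) (vadd V v (vzero V))"
    using assms W_mem(1) by (simp add: ac add_mem add_zero)
  moreover have "vadd V u w \<in> vcoset V W u" "vadd V v (vzero V) \<in> vcoset V W v"
    unfolding vcoset_def using w(1) W_mem(2) by blast+
  ultimately show "z \<in> vadd (vquot V W) (vcoset V W u) (vcoset V W v)"
    unfolding vquot_def vspace.simps by blast
qed

lemma vscale_vcoset:
  assumes "u \<in> carr V"
  shows "vscale (vquot V W) c (vcoset V W u) = vcoset V W (vscale V c u)"
proof (intro equalityI subsetI)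
  fix z assume "z \<in> vscale (vquot V W) c (vcoset V W u)"
  then obtain w w' where w: "w \<in> W" "w' \<in> W" "z = vadd V (vscale V c (vadd V u w)) w'"
    by (auto simp: vquot_def vcoset_def)
  then have "z = vadd V (vscale V c u) (vadd V (vscale V c w) w')"
    using assms W_mem(1) by (simp add: scale_add add_assoc scale_mem)
  with w show "z \<in> vcoset V W (vscale V c u)" unfolding vcoset_def using W_mem(3,4) by blast
next
  fix z assume "z \<in> vcoset V W (vscale V c u)"
  then obtain w where w: "w \<in> W" "z = vadd V (vscale V c u) w" by (auto simp: vcoset_def)
  then have "z = vadd V (vscale V c (vadd V u (vzero V))) w"
    using assms by (simp add: add_zero)
  moreover have "vadd V u (vzero V) \<in> vcoset V W u"
    unfolding vcoset_def using W_mem(2) by blast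
  ultimately show "z \<in> vscale (vquot V W) c (vcoset V W u)"
    using w(1) unfolding vquot_def vspace.simps by blast
qed

lemma vcoset_zero: "vcoset V W (vzero V) = W"
  using W_mem(1) add_zero add_comm zero_mem unfolding vcoset_def by force

lemma vspace_on_vquot: "vspace_on (vquot V W)"
proof -
  have c: "carr (vquot V W) = vcoset V W ` carr V" "vzero (vquot V W) = vcoset V W (vzero V)"
    by (simp_all add: vcoset_zero) (simp_all add: vquot_def)
  show ?thesis
    apply unfold_locales
              apply (auto simp: c vadd_vcoset vscale_vcoset zero_mem add_mem scale_mem add_zero
        scale_add add_scale scale_scale scale_one scale_zero add_assoc)
     apply (metis add_comm)+
    done
qed

end
end

lemma vspace_on_free: "vspace_on free_vspace"
  by unfold_locales (auto simp: free_vspace_def ac_simps free.scale_right_distrib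
    free.scale_left_distrib free.scale_scale intro!: poly_mapping_eqI simp: lookup_add algebra_simps)

lemma vspace_on_tensor: "vspace_on (tensor_space sA sB)"
  unfolding tensor_space_def
  using vspace_on.vspace_on_vquot[OF vspace_on_free] vsubspace_free subspace_tensor_kernel by blast

lemma tensor_space_rules:
  "carr (tensor_space sA sB) = range (tensor_class sA sB)"
  "vzero (tensor_space sA sB) = tensor_class sA sB 0"
  "vadd (tensor_space sA sB) (tensor_class sA sB p) (tensor_class sA sB q) = tensor_class sA sB (p + q)"
  "vscale (tensor_space sA sB) c (tensor_class sA sB p) = tensor_class sA sB (free_scale c p)"
proof -
  have W: "vsubspace free_vspace (tensor_kernel sA sB)"
    using vsubspace_free subspace_tensor_kernel by blast
  note * = vspace_on.vadd_vcoset[OF vspace_on_free W] vspace_on.vscale_vcoset[OF vspace_on_free W]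
    vspace_on.vcoset_zero[OF vspace_on_free W]
  show "carr (tensor_space sA sB) = range (tensor_class sA sB)"
    by (simp add: tensor_space_def vquot_def free_vspace_def tensor_class_def[abs_def])
  show "vzero (tensor_space sA sB) = tensor_class sA sB 0"
    using *(3) by (simp add: tensor_space_def vquot_def tensor_class_def free_vspace_def)
  show "vadd (tensor_space sA sB) (tensor_class sA sB p) (tensor_class sA sB q) = tensor_class sA sB (p + q)"
    using *(1) by (simp add: tensor_space_def tensor_class_def free_vspace_def)
  show "vscale (tensor_space sA sB) c (tensor_class sA sB p) = tensor_class sA sB (free_scale c p)"
    using *(2) by (simp add: tensor_space_def tensor_class_def free_vspace_def)
qed

lemma vsubspace_central_kernel: "vsubspace (tensor_space sS sS) (central_kernel sS)"
proof -
  have "cyclic_relations sS \<subseteq> carr (tensor_space sS sS)"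
    by (auto simp: cyclic_relations_def Let_def tensor_def tensor_space_rules)
  then show ?thesis
    unfolding central_kernel_def by (rule vspace_on.vsubspace_vspan[OF vspace_on_tensor])
qed

lemma central_space_rules:
  "carr (central_space sS) = central_class sS ` carr (tensor_space sS sS)"
  "vzero (central_space sS) = central_class sS (vzero (tensor_space sS sS))"
  "\<lbrakk>A \<in> carr (tensor_space sS sS); B \<in> carr (tensor_space sS sS)\<rbrakk> \<Longrightarrow>
    vadd (central_space sS) (central_class sS A) (central_class sS B) =
      central_class sS (vadd (tensor_space sS sS) A B)"
  "A \<in> carr (tensor_space sS sS) \<Longrightarrow>
    vscale (central_space sS) c (central_class sS A) = central_class sS (vscale (tensor_space sS sS) c A)"
  using vspace_on.vadd_vcoset[OF vspace_on_tensor vsubspace_central_kernel[of sS]]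
    vspace_on.vscale_vcoset[OF vspace_on_tensor vsubspace_central_kernel[of sS]]
    vspace_on.vcoset_zero[OF vspace_on_tensor vsubspace_central_kernel[of sS]]
  by (auto simp: central_space_def central_class_def[abs_def]) (auto simp: vquot_def)

lemma vspace_on_central: "vspace_on (central_space sS)"
  unfolding central_space_def
  by (rule vspace_on.vspace_on_vquot[OF vspace_on_tensor vsubspace_central_kernel])

lemma vspace_on_vdsum:
  assumes "vspace_on V" "vspace_on W" shows "vspace_on (vdsum V W)"
proof -
  interpret V: vspace_on V by fact
  interpret W: vspace_on W by fact
  show ?thesis
    by unfold_locales
      (auto simp: vdsum_def V.zero_mem W.zero_mem V.add_mem W.add_mem V.scale_mem W.scale_mem
        V.add_assoc W.add_assoc V.add_zero W.add_zero V.scale_add W.scale_add V.add_scale W.add_scale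
        V.scale_scale W.scale_scale V.scale_one W.scale_one V.scale_zero W.scale_zero
        intro: V.add_comm W.add_comm)
qed

lemma vspace_on_uce: "vspace_on (uce_space sg sS)"
  unfolding uce_space_def by (intro vspace_on_vdsum vspace_on_tensor vspace_on_central)

lemma (in lie_algebra) uce_bracket_generators:
  assumes "comm_algebra sS"
  shows "uce_bracket scale br sS
      (tensor scale sS x a, central_symbol sS r s) (tensor scale sS y b, central_symbol sS u v) =
    (tensor scale sS (br x y) (a * b),
     vscale (central_space sS) (killing x y) (central_symbol sS a b))"
  unfolding tensor_def central_symbol_def uce_bracket_class[OF assms]
  by (simp add: central_space_rules tensor_space_rules)

lemma (in lie_algebra) uce_bracket_linear:
  fixes sS :: "'k \<Rightarrow> 's::{comm_ring, comm_monoid_mult} \<Rightarrow> 's"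
  assumes "comm_algebra sS"
  defines "L \<equiv> uce_space scale sS" and "lbr \<equiv> uce_bracket scale br sS"
  assumes "X \<in> carr L" "Y \<in> carr L" "Z \<in> carr L"
  shows "lbr X Y \<in> carr L"
    and "lbr (vadd L X Y) Z = vadd L (lbr X Z) (lbr Y Z)"
    and "lbr Z (vadd L X Y) = vadd L (lbr Z X) (lbr Z Y)"
    and "lbr (vscale L c X) Y = vscale L c (lbr X Y)"
    and "lbr X (vscale L c Y) = vscale L c (lbr X Y)"
  using assms(4-6)
  by (auto simp: L_def lbr_def uce_space_def vdsum_def tensor_space_rules central_space_rules
      uce_bracket_class[OF assms(1)] bilinear_ext_add_left bilinear_ext_add_right
      bilinear_ext_scale_left bilinear_ext_scale_right)


section \<open>Modules\<close>

locale lie_module = vector_space sV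
  for sV :: "'k::field \<Rightarrow> 'v::ab_group_add \<Rightarrow> 'v" +
  fixes L :: "('k, 'l) vspace" and lbr :: "'l \<Rightarrow> 'l \<Rightarrow> 'l" and act :: "'l \<Rightarrow> 'v \<Rightarrow> 'v"
  assumes act_vadd: "\<lbrakk>X \<in> carr L; Y \<in> carr L\<rbrakk> \<Longrightarrow> act (vadd L X Y) v = act X v + act Y v"
    and act_vscale: "X \<in> carr L \<Longrightarrow> act (vscale L c X) v = sV c (act X v)"
    and act_add: "X \<in> carr L \<Longrightarrow> act X (v + w) = act X v + act X w"
    and act_scale: "X \<in> carr L \<Longrightarrow> act X (sV c v) = sV c (act X v)"
    and act_bracket: "\<lbrakk>X \<in> carr L; Y \<in> carr L\<rbrakk> \<Longrightarrow>
          act (lbr X Y) v = act X (act Y v) - act Y (act X v)"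
begin

definition submodule :: "'v set \<Rightarrow> bool" where
  "submodule U \<longleftrightarrow> subspace U \<and> (\<forall>X\<in>carr L. \<forall>u\<in>U. act X u \<in> U)"

end

locale simple_lie_module = lie_module sV L lbr act
  for sV :: "'k::field \<Rightarrow> 'v::ab_group_add \<Rightarrow> 'v" and L :: "('k, 'l) vspace" and lbr act +
  assumes nonzero: "\<exists>v::'v. v \<noteq> 0"
    and submodules_trivial: "submodule U \<Longrightarrow> U = {0} \<or> U = UNIV"

text \<open>
  Functionals on the subspace \<open>H\<close>, taken to be \<open>undefined\<close> outside of \<open>H\<close>, so that distinct
  functions are distinct functionals.
\<close>
definition dual_space :: "('k::field \<Rightarrow> 'g::ab_group_add \<Rightarrow> 'g) \<Rightarrow> 'g set \<Rightarrow> ('g \<Rightarrow> 'k) set" where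
  "dual_space sg H = {\<mu> \<in> extensional H.
     (\<forall>x\<in>H. \<forall>y\<in>H. \<mu> (x + y) = \<mu> x + \<mu> y) \<and> (\<forall>c. \<forall>x\<in>H. \<mu> (sg c x) = c * \<mu> x)}"

definition uce_weight_space ::
  "('k::field \<Rightarrow> 'g::ab_group_add \<Rightarrow> 'g) \<Rightarrow> ('k \<Rightarrow> 's::{comm_ring, comm_monoid_mult} \<Rightarrow> 's)
    \<Rightarrow> ('k \<Rightarrow> 'v::ab_group_add \<Rightarrow> 'v) \<Rightarrow> (('k, 'g, 's) uce \<Rightarrow> 'v \<Rightarrow> 'v)
    \<Rightarrow> 'g set \<Rightarrow> ('g \<Rightarrow> 'k) \<Rightarrow> 'v set" where
  "uce_weight_space sg sS sV act H \<mu> =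
     {v. \<forall>h\<in>H. act (tensor sg sS h 1, vzero (central_space sS)) v = sV (\<mu> h) v}"

text \<open>The family \<open>W\<close> of subsets, indexed by \<open>I\<close>, decomposes the whole type as a direct sum.\<close>
definition is_direct_sum :: "'i set \<Rightarrow> ('i \<Rightarrow> 'v::ab_group_add set) \<Rightarrow> bool" where
  "is_direct_sum I W \<longleftrightarrow>
     (\<forall>v. \<exists>!f. finite {i. f i \<noteq> 0} \<and> {i. f i \<noteq> 0} \<subseteq> I \<and> (\<forall>i\<in>I. f i \<in> W i) \<and>
        v = (\<Sum>i\<in>{i. f i \<noteq> 0}. f i))"

definition uce_weight_module ::
  "('k::field \<Rightarrow> 'g::ab_group_add \<Rightarrow> 'g) \<Rightarrow> ('k \<Rightarrow> 's::{comm_ring, comm_monoid_mult} \<Rightarrow> 's)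
    \<Rightarrow> ('k \<Rightarrow> 'v::ab_group_add \<Rightarrow> 'v) \<Rightarrow> (('k, 'g, 's) uce \<Rightarrow> 'v \<Rightarrow> 'v) \<Rightarrow> 'g set \<Rightarrow> bool" where
  "uce_weight_module sg sS sV act H \<longleftrightarrow>
     is_direct_sum (dual_space sg H) (uce_weight_space sg sS sV act H) \<and>
     (\<forall>\<mu>\<in>dual_space sg H.
        \<exists>B. finite B \<and> module.span sV B = uce_weight_space sg sS sV act H \<mu>)"

end

theory Submission
  imports Defs
begin

text \<open>
  Each \<open>\<langle>a, b\<rangle>\<close> commutes with the action and preserves the finite-dimensional weight spaces, so it
  acts by a scalar; moreover \<open>\<langle>1, a\<rangle>\<close> acts by zero.  The \<open>x\<close> such that \<open>x \<otimes> 1\<close> acts by zero form an ideal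
  of the simple algebra.  If it is everything, then all \<open>x \<otimes> a\<close> act by zero, hence so does
  \<open>(x|y) \<langle>a, b\<rangle>\<close>, and Cartan's criterion gives \<open>(x|y) \<noteq> 0\<close> for some \<open>x, y\<close>.  If it is zero, then
  faithfulness transfers to the adjoint action of \<open>H\<close> the commutativity and semisimplicity of its
  action on the module; therefore the Killing form is not zero on \<open>H\<close>.  For \<open>h, h' \<in> H\<close> with
  \<open>(h|h') \<noteq> 0\<close> the operators \<open>h \<otimes> a\<close> and \<open>h' \<otimes> b\<close> preserve a nonzero weight space, and the trace of
  their commutator \<open>(h|h') \<langle>a, b\<rangle>\<close> on it vanishes.
\<close>

section \<open>Generalized eigenspaces and traces\<close>

locale linear_operators = vector_space scale
  for scale :: "'a::field \<Rightarrow> 'b::ab_group_add \<Rightarrow> 'b"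
begin

abbreviation endo :: "('b \<Rightarrow> 'b) \<Rightarrow> bool" where
  "endo \<equiv> Vector_Spaces.linear scale scale"

lemma endoI:
  assumes "\<And>x y. f (x + y) = f x + f y" "\<And>c x. f (scale c x) = scale c (f x)"
  shows "endo f"
  unfolding Vector_Spaces.linear_iff using assms vector_space_axioms by blast

lemma endoD:
  assumes "endo f"
  shows "f (x + y) = f x + f y" "f (scale c x) = scale c (f x)" "f 0 = 0" "f (x - y) = f x - f y"
    "f (- x) = - f x" "f (\<Sum>i\<in>I. g i) = (\<Sum>i\<in>I. f (g i))"
proof -
  interpret Vector_Spaces.linear scale scale f by fact
  show "f (x + y) = f x + f y" "f (scale c x) = scale c (f x)" "f 0 = 0" "f (x - y) = f x - f y"
    "f (- x) = - f x" "f (\<Sum>i\<in>I. g i) = (\<Sum>i\<in>I. f (g i))"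
    by (simp_all add: add scale diff neg sum)
qed

lemma endo_subspace_vimage: "endo f \<Longrightarrow> subspace U \<Longrightarrow> subspace {v. f v \<in> U}"
  unfolding subspace_def by (simp add: endoD)

lemma finite_independent:
  assumes "finite S" "span S = UNIV" "independent B" shows "finite B"
  using independent_span_bound[OF assms(1,3)] assms(2) by simp

text \<open>This is a trace only if \<open>f\<close> maps \<open>B\<close> into
  \<open>span B\<close>; outside that span \<open>representation\<close> is 0 by default. With
  \<open>B\<close> as an argument the same notion serves the whole space and a single weight space
  of an infinite-dimensional module.\<close>

definition trace_on :: "'b set \<Rightarrow> ('b \<Rightarrow> 'b) \<Rightarrow> 'a" where
  "trace_on B f = (\<Sum>b\<in>B. representation B (f b) b)"

lemma endo_sum_representation:
  assumes g: "endo g" and C: "finite C" "independent C" and v: "v \<in> span C"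
  shows "g v = (\<Sum>c\<in>C. scale (representation C v c) (g c))"
proof -
  have "g (\<Sum>c\<in>C. scale (representation C v c) c) = (\<Sum>c\<in>C. scale (representation C v c) (g c))"
    by (simp add: endoD(2,6)[OF g])
  then show ?thesis by (simp only: sum_representation_eq[OF C(2) v C(1) subset_refl])
qed

text \<open>Both traces expand to the same double sum of products of matrix entries. Two bases are
  allowed so that one map being the identity gives independence of the basis, and
  \<open>B = C\<close> gives cyclicity.\<close>

lemma trace_on_comm:
  assumes B: "finite B" "independent B" and C: "finite C" "independent C"
    and f: "endo f" "f ` B \<subseteq> span C" and g: "endo g" "g ` C \<subseteq> span B"
  shows "trace_on B (\<lambda>v. g (f v)) = trace_on C (\<lambda>v. f (g v))"
proof -
  have gf: "representation B (g (f b)) b =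
      (\<Sum>c\<in>C. representation C (f b) c * representation B (g c) b)" if "b \<in> B" for b
  proof -
    have "f b \<in> span C" using f(2) that by blast
    from endo_sum_representation[OF g(1) C this] show ?thesis
      using g(2) by (simp add: representation_sum[OF B(2)] representation_scale[OF B(2)] span_scale
          image_subset_iff)
  qed
  have fg: "representation C (f (g c)) c =
      (\<Sum>b\<in>B. representation B (g c) b * representation C (f b) c)" if "c \<in> C" for c
  proof -
    have "g c \<in> span B" using g(2) that by blast
    from endo_sum_representation[OF f(1) B this] show ?thesis
      using f(2) by (simp add: representation_sum[OF C(2)] representation_scale[OF C(2)] span_scale
          image_subset_iff)
  qed
  show ?thesis
    unfolding trace_on_def by (simp add: gf fg) (subst sum.swap, simp add: mult.commute)
qed

lemma linear_trace_eq_trace_on: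
  assumes B: "finite B" "independent B" "span B = UNIV" and f: "endo f"
  shows "linear_trace scale f = trace_on B f"
proof -
  let ?C = "extend_basis {}"
  have C: "independent ?C" "span ?C = UNIV"
    by (simp_all add: independent_extend_basis independent_empty span_extend_basis)
  have "finite ?C" using finite_independent[OF B(1,3) C(1)] .
  then have "trace_on ?C (\<lambda>v. f v) = trace_on B (\<lambda>v. f v)"
    using trace_on_comm[OF _ C(1) B(1,2) linear_ident _ f] B C by (simp add: image_subset_iff)
  then show ?thesis by (simp add: linear_trace_def trace_on_def)
qed

section \<open>Generalized eigenspaces\<close>

definition shift :: "('b \<Rightarrow> 'b) \<Rightarrow> 'a \<Rightarrow> 'b \<Rightarrow> 'b" where
  "shift f c v = f v - scale c v"

lemma endo_shift: "endo f \<Longrightarrow> endo (shift f c)"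
  by (rule endoI) (simp_all add: shift_def endoD algebra_simps)

lemma endo_funpow: "endo f \<Longrightarrow> endo (f ^^ n)"
  by (induction n) (auto intro!: endoI simp: endoD)

text \<open>The exponent may depend on the vector, so the definition refers to no dimension.\<close>

definition gen_eigenspace :: "('b \<Rightarrow> 'b) \<Rightarrow> 'a \<Rightarrow> 'b set" where
  "gen_eigenspace f c = {v. \<exists>n. (shift f c ^^ n) v = 0}"

lemma funpow_zero_mono:
  assumes "endo f" "(f ^^ n) v = 0" "n \<le> m" shows "(f ^^ m) v = 0"
proof -
  have "(f ^^ (m - n + n)) v = (f ^^ (m - n)) ((f ^^ n) v)" by (simp add: funpow_add)
  then show ?thesis using assms endoD(3)[OF endo_funpow[OF assms(1)]] by simp
qed

lemma gen_eigenspace_subspace: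
  assumes "endo f" shows "subspace (gen_eigenspace f c)"
proof (rule subspaceI)
  note S = endo_shift[OF assms, of c]
  show "0 \<in> gen_eigenspace f c"
    unfolding gen_eigenspace_def by (intro CollectI exI[of _ 0]) simp
  fix x y assume "x \<in> gen_eigenspace f c" "y \<in> gen_eigenspace f c"
  then obtain n m where "(shift f c ^^ n) x = 0" "(shift f c ^^ m) y = 0"
    by (auto simp: gen_eigenspace_def)
  then have "(shift f c ^^ max n m) x = 0" "(shift f c ^^ max n m) y = 0"
    using funpow_zero_mono[OF S] by (meson max.cobounded1 max.cobounded2)+
  then show "x + y \<in> gen_eigenspace f c"
    unfolding gen_eigenspace_def
    by (intro CollectI exI[of _ "max n m"]) (simp add: endoD(1)[OF endo_funpow[OF S]])
next
  fix a x assume "x \<in> gen_eigenspace f c"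
  then show "scale a x \<in> gen_eigenspace f c"
    unfolding gen_eigenspace_def
    by (auto simp: endoD(2)[OF endo_funpow[OF endo_shift[OF assms]]])
qed

lemma shift_mem_gen_eigenspace_iff:
  assumes "endo f"
  shows "shift f c v \<in> gen_eigenspace f c \<longleftrightarrow> v \<in> gen_eigenspace f c"
proof
  assume "shift f c v \<in> gen_eigenspace f c"
  then obtain n where "(shift f c ^^ n) (shift f c v) = 0" by (auto simp: gen_eigenspace_def)
  then have "(shift f c ^^ Suc n) v = 0" by (simp only: funpow_Suc_right o_apply)
  then show "v \<in> gen_eigenspace f c" unfolding gen_eigenspace_def by blast
next
  assume "v \<in> gen_eigenspace f c"
  then obtain n where "(shift f c ^^ n) v = 0" by (auto simp: gen_eigenspace_def)
  then have "(shift f c ^^ n) (shift f c v) = 0"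
    using endoD(3)[OF endo_shift[OF assms]] by (simp flip: funpow_swap1)
  then show "shift f c v \<in> gen_eigenspace f c" unfolding gen_eigenspace_def by blast
qed

lemma shift_shift: "shift f c v = shift f d v + scale (d - c) v"
  by (simp add: shift_def scale_left_diff_distrib)

lemma gen_eigenspace_shift_other:
  assumes "endo f" "v \<in> gen_eigenspace f c"
  shows "shift f d v \<in> gen_eigenspace f c"
  using assms shift_shift[of f d v c] gen_eigenspace_subspace[OF assms(1), of c]
  by (simp add: shift_mem_gen_eigenspace_iff subspace_add subspace_scale)

text \<open>On this space \<open>f - d\<close> is the nonzero scalar \<open>c - d\<close> plus a
  locally nilpotent operator, hence invertible. The induction on the nilpotency order replaces the
  geometric series.\<close>

lemma gen_eigenspace_shift_surj:
  assumes f: "endo f" and "c \<noteq> d" and v: "v \<in> gen_eigenspace f c"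
  shows "\<exists>u\<in>gen_eigenspace f c. shift f d u = v"
proof -
  note S = gen_eigenspace_subspace[OF f, of c] and L = endo_shift[OF f, of d]
  have "(shift f c ^^ n) v = 0 \<Longrightarrow> \<exists>u\<in>gen_eigenspace f c. shift f d u = v" for n v
  proof (induction n arbitrary: v)
    case 0
    then show ?case using subspace_0[OF S] endoD(3)[OF L] by auto
  next
    case (Suc n)
    \<comment> \<open>A first approximation to the preimage of \<open>v\<close>; its error
      \<open>shift f c w\<close> is killed by one power fewer.\<close>
    define w where "w = scale (inverse (c - d)) v"
    have w: "shift f d w = v + shift f c w"
      using \<open>c \<noteq> d\<close> by (simp add: shift_shift[of f d w c]) (simp add: w_def)
    have sw: "shift f c w = scale (inverse (c - d)) (shift f c v)"
      by (simp add: w_def endoD[OF endo_shift[OF f]])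
    have "(shift f c ^^ n) (shift f c v) = 0"
      using Suc.prems by (simp only: funpow_Suc_right o_apply)
    then have "(shift f c ^^ n) (shift f c w) = 0"
      by (simp add: sw endoD(2)[OF endo_funpow[OF endo_shift[OF f]]])
    then obtain u where u: "u \<in> gen_eigenspace f c" "shift f d u = shift f c w"
      using Suc.IH by blast
    have "v \<in> gen_eigenspace f c" using Suc.prems unfolding gen_eigenspace_def by blast
    then have "w - u \<in> gen_eigenspace f c"
      using u S by (simp add: w_def subspace_diff subspace_scale)
    moreover have "shift f d (w - u) = v" by (simp add: endoD(4)[OF L] w u)
    ultimately show ?case by blast
  qed
  then show ?thesis using v by (auto simp: gen_eigenspace_def)
qed

text \<open>On a vector killed by \<open>f - d\<close>, the operator \<open>f - c\<close> is the
  scalar \<open>d - c\<close>, none of whose powers vanish.\<close>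

lemma gen_eigenspace_shift_inj:
  assumes f: "endo f" and "c \<noteq> d" and v: "v \<in> gen_eigenspace f c" "shift f d v = 0"
  shows "v = 0"
proof -
  have "shift f c v = scale (d - c) v" using shift_shift[of f c v d] v(2) by simp
  then have "(shift f c ^^ n) v = scale ((d - c) ^ n) v" for n
    by (induction n) (simp_all add: endoD(2)[OF endo_shift[OF f]] mult.commute)
  then show ?thesis using v(1) \<open>c \<noteq> d\<close> by (auto simp: gen_eigenspace_def)
qed

lemma gen_eigenspace_shift_funpow_inj:
  assumes f: "endo f" and "c \<noteq> d" and v: "v \<in> gen_eigenspace f c" "(shift f d ^^ n) v = 0"
  shows "v = 0"
  using v
proof (induction n arbitrary: v)
  case (Suc n)
  then have "(shift f d ^^ n) (shift f d v) = 0" by (simp only: funpow_Suc_right o_apply)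
  then have "shift f d v = 0" using Suc.IH gen_eigenspace_shift_other[OF f Suc.prems(1)] by blast
  then show ?case using gen_eigenspace_shift_inj[OF f \<open>c \<noteq> d\<close> Suc.prems(1)] by simp
qed simp

text \<open>A power of \<open>f - d\<close> that kills \<open>v d\<close> turns the relation into
  one among the other terms, which stay in their generalized eigenspaces; there \<open>f - d\<close>
  is injective, so the induction hypothesis carries back.\<close>

lemma gen_eigenspace_independent:
  assumes f: "endo f" and "finite F" and "\<And>c. c \<in> F \<Longrightarrow> v c \<in> gen_eigenspace f c"
    and "(\<Sum>c\<in>F. v c) = 0" and "c \<in> F"
  shows "v c = 0"
  using assms(2-5)
proof (induction F arbitrary: v c rule: finite_induct)
  case (insert d F)
  obtain n where n: "(shift f d ^^ n) (v d) = 0"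
    using insert.prems(1)[of d] by (auto simp: gen_eigenspace_def)
  note L = endo_funpow[OF endo_shift[OF f], of n d]
  have mem: "(shift f d ^^ m) (v c) \<in> gen_eigenspace f c" if "c \<in> F" for c m
    using insert.prems(1)[of c] that
    by (induction m) (auto intro: gen_eigenspace_shift_other[OF f])
  have "(shift f d ^^ n) (\<Sum>c\<in>insert d F. v c) = 0"
    using insert.prems(2) endoD(3)[OF L] by simp
  then have "(\<Sum>c\<in>F. (shift f d ^^ n) (v c)) = 0"
    using insert.hyps n by (simp add: endoD[OF L])
  then have "(shift f d ^^ n) (v c) = 0" if "c \<in> F" for c
    using insert.IH[of "\<lambda>c. (shift f d ^^ n) (v c)"] mem that by blast
  then have z: "v c = 0" if "c \<in> F" for c
    using gen_eigenspace_shift_funpow_inj[OF f] insert.prems(1) insert.hyps that by (metis insertCI)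
  then have "v d = 0" using insert by simp
  then show ?case using z insert.prems(3) by auto
qed simp

section \<open>Polynomials in an endomorphism\<close>

definition eval_poly :: "('b \<Rightarrow> 'b) \<Rightarrow> 'a poly \<Rightarrow> 'b \<Rightarrow> 'b" where
  "eval_poly f p v = (\<Sum>i\<le>degree p. scale (coeff p i) ((f ^^ i) v))"

lemma eval_poly_bound:
  assumes "degree p \<le> n"
  shows "eval_poly f p v = (\<Sum>i\<le>n. scale (coeff p i) ((f ^^ i) v))"
  unfolding eval_poly_def using assms
  by (intro sum.mono_neutral_left) (auto simp: coeff_eq_0)

lemma eval_poly_add: "eval_poly f (p + q) v = eval_poly f p v + eval_poly f q v"
proof -
  let ?n = "max (degree p) (degree q)"
  show ?thesis
    using eval_poly_bound[of _ ?n f v] degree_add_le_max[of p q]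
    by (simp add: scale_left_distrib sum.distrib)
qed

lemma eval_poly_smult: "eval_poly f (smult c p) v = scale c (eval_poly f p v)"
  using eval_poly_bound[OF degree_smult_le[of c p]] by (simp add: eval_poly_def scale_sum_right)

lemma eval_poly_pCons_0:
  assumes "endo f" shows "eval_poly f (pCons 0 p) v = f (eval_poly f p v)"
proof -
  have "degree (pCons 0 p) \<le> Suc (degree p)" by (rule degree_pCons_le)
  then show ?thesis
    by (simp add: eval_poly_bound sum.atMost_Suc_shift del: sum.atMost_Suc)
       (simp add: eval_poly_def endoD[OF assms])
qed

lemma eval_poly_monom: "eval_poly f (monom c n) v = scale c ((f ^^ n) v)"
proof -
  have "eval_poly f (monom c n) v = (\<Sum>i\<le>n. if i = n then scale c ((f ^^ i) v) else 0)"
    by (subst eval_poly_bound[OF degree_monom_le]) (rule sum.cong, auto)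
  then show ?thesis by simp
qed

lemma eval_poly_linear_factor:
  assumes "endo f"
  shows "eval_poly f ([:- c, 1:] * p) v = shift f c (eval_poly f p v)"
proof -
  have "[:- c, 1:] * p = smult (- c) p + pCons 0 p" by simp
  then show ?thesis
    by (simp only: eval_poly_add eval_poly_smult eval_poly_pCons_0[OF assms]) (simp add: shift_def)
qed

text \<open>Otherwise the iterates of \<open>u\<close> under \<open>f\<close> would be independent,
  too many for \<open>span S\<close>. Only \<open>U\<close> has to be finite dimensional, which
  allows weight spaces of an infinite-dimensional module.\<close>

lemma annihilating_poly:
  assumes f: "endo f" and S: "finite S" and U: "subspace U" "U \<subseteq> span S" "f ` U \<subseteq> U" and u: "u \<in> U"
  shows "\<exists>p. p \<noteq> 0 \<and> eval_poly f p u = 0"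
proof (rule ccontr)
  assume *: "\<nexists>p. p \<noteq> 0 \<and> eval_poly f p u = 0"
  define A where "A n = (\<lambda>i. (f ^^ i) u) ` {..<n}" for n
  \<comment> \<open>Vanishing of the coefficients from \<open>n\<close> on, rather than
    \<open>degree p < n\<close>, also covers \<open>n = 0\<close>, where only the zero polynomial is
    left.\<close>
  have span_A: "span (A n) \<subseteq> {eval_poly f p u |p. \<forall>i\<ge>n. coeff p i = 0}" for n
  proof (rule span_minimal)
    show "A n \<subseteq> {eval_poly f p u |p. \<forall>i\<ge>n. coeff p i = 0}"
    proof
      fix x assume "x \<in> A n"
      then obtain i where "i < n" "x = eval_poly f (monom 1 i) u"
        by (auto simp: A_def eval_poly_monom)
      then show "x \<in> {eval_poly f p u |p. \<forall>i\<ge>n. coeff p i = 0}" by force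
    qed
    show "subspace {eval_poly f p u |p. \<forall>i\<ge>n. coeff p i = 0}"
    proof (rule subspaceI)
      show "0 \<in> {eval_poly f p u |p. \<forall>i\<ge>n. coeff p i = 0}"
        by (intro CollectI exI[of _ 0]) (simp add: eval_poly_def)
    qed (force simp flip: eval_poly_add eval_poly_smult)+
  qed
  have notin: "(f ^^ n) u \<notin> span (A n)" for n
  proof
    assume "(f ^^ n) u \<in> span (A n)"
    then obtain p where p: "(f ^^ n) u = eval_poly f p u" "\<forall>i\<ge>n. coeff p i = 0"
      using span_A by blast
    have "eval_poly f (monom 1 n + smult (-1) p) u = 0"
      by (simp only: eval_poly_add eval_poly_smult eval_poly_monom p(1)) simp
    moreover have "coeff (monom 1 n + smult (-1) p) n \<noteq> 0" using p(2) by simp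
    ultimately show False using * by (metis coeff_0)
  qed
  have fu: "(f ^^ i) u \<in> U" for i by (induction i) (use u U(3) in auto)
  have "independent (A n) \<and> card (A n) = n" for n
  proof (induction n)
    case 0 show ?case by (simp add: A_def independent_empty)
  next
    case (Suc n)
    have "A (Suc n) = insert ((f ^^ n) u) (A n)" by (auto simp: A_def lessThan_Suc)
    moreover have "(f ^^ n) u \<notin> A n" using notin span_base by blast
    moreover have "finite (A n)" by (simp add: A_def)
    ultimately show ?case using Suc notin by (simp add: independent_insert)
  qed
  moreover have "A n \<subseteq> span S" for n using fu U(2) by (auto simp: A_def)
  ultimately show False
    using independent_span_bound[OF S, of "A (Suc (card S))"] by force
qed

end

section \<open>Decomposition over an algebraically closed field\<close>

locale alg_closed_linear_operators = linear_operators scale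
  for scale :: "'k::alg_closed_field \<Rightarrow> 'v::ab_group_add \<Rightarrow> 'v"
begin

text \<open>Take \<open>p\<close> of least degree with \<open>p(f) u\<close> in \<open>W\<close> and
  split off a root \<open>c\<close>: the cofactor \<open>q\<close> gives \<open>q(f) u\<close>,
  outside \<open>W\<close> by minimality. With \<open>W = {0}\<close> this yields an ordinary
  eigenvector in \<open>U\<close>.\<close>

lemma eigenvector_modulo:
  assumes f: "endo f" and S: "finite S" and U: "subspace U" "U \<subseteq> span S" "f ` U \<subseteq> U"
    and W: "subspace W" and UW: "\<not> U \<subseteq> W"
  shows "\<exists>v\<in>U - W. \<exists>c. shift f c v \<in> W"
proof -
  obtain u where u: "u \<in> U" "u \<notin> W" using UW by blast
  define P where "P p \<longleftrightarrow> p \<noteq> 0 \<and> eval_poly f p u \<in> W" for p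
  obtain p0 where "p0 \<noteq> 0" "eval_poly f p0 u = 0" using annihilating_poly[OF f S U u(1)] by blast
  then have "P p0" using subspace_0[OF W] by (simp add: P_def)
  then have "\<exists>p. P p \<and> (\<forall>q. P q \<longrightarrow> degree p \<le> degree q)" by (rule ex_has_least_nat)
  then obtain p where "P p" and min: "\<And>q. P q \<Longrightarrow> degree p \<le> degree q" by blast
  then have p: "p \<noteq> 0" "eval_poly f p u \<in> W" by (simp_all add: P_def)
  have "degree p > 0"
  proof (rule ccontr)
    assume "\<not> degree p > 0"
    then have "degree p = 0" by simp
    then obtain a where a: "p = [:a:]" by (rule degree_eq_zeroE)
    then have "a \<noteq> 0" "scale a u \<in> W" using p by (simp_all add: eval_poly_def)
    then show False using u(2) subspace_scale[OF W, of "scale a u" "inverse a"] by simp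
  qed
  then obtain c where "poly p c = 0" using alg_closed_imp_poly_has_root by blast
  then obtain q where q: "p = [:- c, 1:] * q" by (auto simp: poly_eq_0_iff_dvd)
  then have "q \<noteq> 0" using p(1) by auto
  moreover have "degree p = degree [:- c, 1:] + degree q"
    unfolding q by (rule degree_mult_eq) (use \<open>q \<noteq> 0\<close> in simp_all)
  ultimately have "q \<noteq> 0" "degree q < degree p" by simp_all
  then have "eval_poly f q u \<notin> W" using min[of q] by (auto simp: P_def)
  moreover have "eval_poly f q u \<in> U"
  proof -
    have "(f ^^ i) u \<in> U" for i by (induction i) (use u U(3) in auto)
    then show ?thesis unfolding eval_poly_def by (intro subspace_sum subspace_scale U(1))
  qed
  moreover have "shift f c (eval_poly f q u) \<in> W"
    using p(2) eval_poly_linear_factor[OF f] q by simp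
  ultimately show ?thesis by blast
qed

text \<open>The generalized eigenspaces for \<open>d \<noteq> c\<close> lie in the image of
  \<open>f - c\<close>; the one for \<open>c\<close> supplies the second summand.\<close>

lemma span_gen_eigenspaces_step:
  assumes f: "endo f" and w: "w \<in> span (\<Union>d. gen_eigenspace f d)"
  shows "\<exists>u\<in>span (\<Union>d. gen_eigenspace f d). \<exists>w'\<in>gen_eigenspace f c. w = shift f c u + w'"
proof -
  let ?W = "span (\<Union>d. gen_eigenspace f d)"
  let ?T = "{x + y |x y. x \<in> shift f c ` ?W \<and> y \<in> gen_eigenspace f c}"
  have Z: "0 \<in> gen_eigenspace f c" by (rule subspace_0[OF gen_eigenspace_subspace[OF f]])
  have "gen_eigenspace f d \<subseteq> ?T" for d
  proof
    fix v assume v: "v \<in> gen_eigenspace f d"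
    show "v \<in> ?T"
    proof (cases "d = c")
      case True
      have "0 = shift f c 0" using endoD(3)[OF endo_shift[OF f]] by simp
      then have "0 \<in> shift f c ` ?W" using span_zero by blast
      then show ?thesis using v True by force
    next
      case False
      then obtain u where "u \<in> gen_eigenspace f d" "shift f c u = v"
        using gen_eigenspace_shift_surj[OF f _ v] by blast
      then have "v \<in> shift f c ` ?W" using span_base by blast
      then show ?thesis using Z by force
    qed
  qed
  moreover have "subspace (shift f c ` ?W)"
  proof -
    interpret Vector_Spaces.linear scale scale "shift f c" using endo_shift[OF f] .
    show ?thesis by (rule subspace_image) simp
  qed
  then have "subspace ?T"
    using subspace_sums gen_eigenspace_subspace[OF f] by blast
  ultimately have "?W \<subseteq> ?T" by (intro span_minimal UN_least)
  then show ?thesis using w by blast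
qed

text \<open>An eigenvector \<open>v\<close> modulo the span can be corrected by an element
  \<open>u\<close> of the span so that \<open>(f - c) (v - u)\<close> lies in the generalized
  eigenspace for \<open>c\<close>. Then so does \<open>v - u\<close>, and \<open>v\<close> was in
  the span after all.\<close>

lemma span_gen_eigenspaces:
  assumes f: "endo f" and S: "finite S" "span S = UNIV"
  shows "span (\<Union>c. gen_eigenspace f c) = UNIV"
proof (rule ccontr)
  let ?W = "span (\<Union>c. gen_eigenspace f c)"
  assume "?W \<noteq> UNIV"
  then have "\<exists>v\<in>UNIV - ?W. \<exists>c. shift f c v \<in> ?W"
    using S by (intro eigenvector_modulo[OF f S(1)]) auto
  then obtain v c where v: "v \<notin> ?W" "shift f c v \<in> ?W" by blast
  then obtain u w where u: "u \<in> ?W" "w \<in> gen_eigenspace f c" "shift f c v = shift f c u + w"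
    using span_gen_eigenspaces_step[OF f] by blast
  then have "shift f c (v - u) = w" by (simp add: endoD[OF endo_shift[OF f]])
  then have "v - u \<in> ?W" using u(2) shift_mem_gen_eigenspace_iff[OF f, of c "v - u"] span_base by blast
  then have "v - u + u \<in> ?W" using u(1) by (rule span_add)
  then show False using v(1) by simp
qed

text \<open>Fitting's decomposition at the eigenvalue 0; the hypothesis \<open>ss\<close> shrinks
  the generalized kernel to the kernel.\<close>

lemma fitting_decomposition:
  assumes f: "endo f" and S: "finite S" "span S = UNIV" and ss: "\<And>v. f (f v) = 0 \<Longrightarrow> f v = 0"
  shows "\<exists>u w. v = f u + w \<and> f w = 0"
proof -
  have "v \<in> span (\<Union>c. gen_eigenspace f c)" using span_gen_eigenspaces[OF f S] by simp
  then obtain u w where uw: "w \<in> gen_eigenspace f 0" "v = shift f 0 u + w"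
    using span_gen_eigenspaces_step[OF f] by blast
  have sh: "shift f 0 = f" by (simp add: shift_def fun_eq_iff)
  have "(f ^^ n) x = 0 \<Longrightarrow> f x = 0" for n x
  proof (induction n arbitrary: x)
    case (Suc n)
    then have "(f ^^ n) (f x) = 0" by (simp only: funpow_Suc_right o_apply)
    then show ?case using Suc.IH ss by blast
  qed (simp add: endoD[OF f])
  then have "f w = 0" using uw(1) by (auto simp: gen_eigenspace_def sh)
  then show ?thesis using uw(2) sh by auto
qed

text \<open>The last property says that \<open>f - ev b\<close> has diagonal entry 0 at
  \<open>b\<close>. This weak substitute for a triangular form is enough for computing traces, and a
  set of largest cardinality with these properties is a basis.\<close>

lemma gen_eigenbasis:
  assumes f: "endo f" and S: "finite S" "span S = UNIV"
  obtains B ev where "finite B" "independent B" "span B = UNIV"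
    "\<And>b. b \<in> B \<Longrightarrow> b \<in> gen_eigenspace f (ev b)"
    "\<And>b. b \<in> B \<Longrightarrow> shift f (ev b) b \<in> span (B - {b})"
proof -
  define P where "P B \<longleftrightarrow> independent B \<and>
    (\<forall>b\<in>B. \<exists>c. b \<in> gen_eigenspace f c \<and> shift f c b \<in> span (B - {b}))" for B
  have "P {}" by (simp add: P_def independent_empty)
  moreover have "\<forall>B. P B \<longrightarrow> card B < Suc (card S)"
    using independent_span_bound[OF S(1)] S(2) by (auto simp: P_def less_Suc_eq_le)
  ultimately have "\<exists>B. P B \<and> (\<forall>C. P C \<longrightarrow> card C \<le> card B)"
    by (rule ex_has_greatest_nat)
  then obtain B where B: "P B" and max: "\<And>C. P C \<Longrightarrow> card C \<le> card B" by blast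
  have fin: "finite B" using B finite_independent[OF S] by (simp add: P_def)
  have "span B = UNIV"
  proof (rule ccontr)
    assume "span B \<noteq> UNIV"
    then have "\<not> (\<Union>c. gen_eigenspace f c) \<subseteq> span B"
      using span_minimal[OF _ subspace_span] span_gen_eigenspaces[OF f S] by blast
    then obtain v c where v: "v \<in> gen_eigenspace f c" "v \<notin> span B" by blast
    then obtain n where "(shift f c ^^ n) v = 0" by (auto simp: gen_eigenspace_def)
    then have "(shift f c ^^ n) v \<in> span B" by (simp add: span_zero)
    \<comment> \<open>The last iterate outside \<open>span B\<close> can be added to
      \<open>B\<close>: one more shift sends it into the span of the old vectors.\<close>
    then obtain m where m: "(shift f c ^^ m) v \<notin> span B" "(shift f c ^^ Suc m) v \<in> span B"
      using v(2) by (induction n) auto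
    define w where "w = (shift f c ^^ m) v"
    have "(shift f c ^^ m) v \<in> gen_eigenspace f c"
      by (induction m) (use v(1) gen_eigenspace_shift_other[OF f] in auto)
    then have w: "w \<notin> span B" "shift f c w \<in> span B" "w \<in> gen_eigenspace f c"
      using m by (simp_all add: w_def)
    then have wB: "w \<notin> B" using span_base by blast
    have "P (insert w B)"
      unfolding P_def
    proof (intro conjI ballI)
      show "independent (insert w B)" using B w by (simp add: P_def independent_insert)
      fix b assume b: "b \<in> insert w B"
      show "\<exists>c. b \<in> gen_eigenspace f c \<and> shift f c b \<in> span (insert w B - {b})"
      proof (cases "b = w")
        case True
        then show ?thesis using w wB by auto
      next
        case False
        then obtain d where "b \<in> gen_eigenspace f d" "shift f d b \<in> span (B - {b})"
          using B b by (auto simp: P_def)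
        moreover have "span (B - {b}) \<subseteq> span (insert w B - {b})" by (intro span_mono) auto
        ultimately show ?thesis by blast
      qed
    qed
    then show False using max[of "insert w B"] fin wB by simp
  qed
  moreover obtain ev where "\<forall>b\<in>B. b \<in> gen_eigenspace f (ev b) \<and> shift f (ev b) b \<in> span (B - {b})"
    using B unfolding P_def by metis
  ultimately show ?thesis using that fin B unfolding P_def by blast
qed

text \<open>For \<open>\<phi> = id\<close> the operator \<open>D\<close> is the semisimple part of \<open>f\<close>.\<close>

lemma gen_eigenspace_operator:
  assumes f: "endo f" and S: "finite S" "span S = UNIV"
  obtains B ev where "finite B" "span B = UNIV" "\<And>b. b \<in> B \<Longrightarrow> b \<in> gen_eigenspace f (ev b)"
    "\<And>\<phi>. \<exists>D. endo D \<and> (\<forall>c. \<forall>v\<in>gen_eigenspace f c. D v = scale (\<phi> c) v) \<and>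
      linear_trace scale (\<lambda>v. f (D v)) = (\<Sum>b\<in>B. \<phi> (ev b) * ev b)"
proof -
  obtain B ev where B: "finite B" "independent B" "span B = UNIV"
    and ev: "\<And>b. b \<in> B \<Longrightarrow> b \<in> gen_eigenspace f (ev b)"
    "\<And>b. b \<in> B \<Longrightarrow> shift f (ev b) b \<in> span (B - {b})"
    using gen_eigenbasis[OF f S] by blast
  interpret VP: vector_space_pair scale scale ..
  have "\<exists>D. endo D \<and> (\<forall>c. \<forall>v\<in>gen_eigenspace f c. D v = scale (\<phi> c) v) \<and>
      linear_trace scale (\<lambda>v. f (D v)) = (\<Sum>b\<in>B. \<phi> (ev b) * ev b)" for \<phi>
  proof -
    obtain D where D: "endo D" "\<And>b. b \<in> B \<Longrightarrow> D b = scale (\<phi> (ev b)) b"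
      using VP.linear_independent_extend[OF B(2), of "\<lambda>b. scale (\<phi> (ev b)) b"] by blast
    have "D v = scale (\<phi> c) v" if v: "v \<in> gen_eigenspace f c" for v c
    proof -
      let ?r = "representation B v"
      \<comment> \<open>\<open>c\<close> is inserted because it need not occur as a value of
        \<open>ev\<close>; in that case \<open>w c\<close> is an empty sum and
        \<open>v = 0\<close>.\<close>
      let ?F = "insert c (ev ` B)"
      define w where "w d = (\<Sum>b | b \<in> B \<and> ev b = d. scale (?r b) b)" for d
      \<comment> \<open>The components of \<open>v\<close> minus \<open>v\<close> itself in place
        \<open>c\<close> sum to zero, so independence identifies \<open>v\<close> with its component
        \<open>w c\<close>.\<close>
      define x where "x d = w d - (if d = c then v else 0)" for d
      have wm: "w d \<in> gen_eigenspace f d" for d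
        unfolding w_def using gen_eigenspace_subspace[OF f] ev(1)
        by (auto intro!: subspace_sum subspace_scale)
      have "x d \<in> gen_eigenspace f d" for d
        using wm[of d] v gen_eigenspace_subspace[OF f, of d] by (auto simp: x_def subspace_diff)
      moreover have "(\<Sum>d\<in>?F. x d) = 0"
      proof -
        have "(\<Sum>d\<in>?F. w d) = (\<Sum>b\<in>B. scale (?r b) b)"
          unfolding w_def using B(1) by (intro sum.group) auto
        also have "\<dots> = v"
          using sum_representation_eq[OF B(2) _ B(1) subset_refl, of v] B(3) by simp
        finally show ?thesis using B(1) by (simp add: x_def sum_subtractf)
      qed
      ultimately have "x c = 0"
        using gen_eigenspace_independent[OF f, of ?F x c] B(1) by auto
      then have "v = w c" by (simp add: x_def)
      moreover have "D (w c) = scale (\<phi> c) (w c)"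
        using D by (simp add: w_def endoD scale_sum_right mult.commute)
      ultimately show ?thesis by simp
    qed
    moreover have "linear_trace scale (\<lambda>v. f (D v)) = (\<Sum>b\<in>B. \<phi> (ev b) * ev b)"
    proof -
      have "representation B (f (D b)) b = \<phi> (ev b) * ev b" if b: "b \<in> B" for b
      proof -
        let ?z = "shift f (ev b) b"
        have "representation B ?z b = 0"
        proof -
          have "independent (B - {b})" using B(2) independent_mono by blast
          then have "representation B ?z = representation (B - {b}) ?z"
            using representation_extend[OF B(2) ev(2)[OF b]] by blast
          then show ?thesis using representation_ne_zero[of "B - {b}" ?z b] by auto
        qed
        moreover have "representation B b b = 1" using representation_basis[OF B(2) b] by simp
        moreover have "f (D b) = scale (\<phi> (ev b)) (?z + scale (ev b) b)"
          using D(2)[OF b] by (simp add: endoD[OF f] shift_def)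
        ultimately show ?thesis
          using B(3) by (simp add: representation_scale[OF B(2)] representation_add[OF B(2)])
      qed
      moreover have "endo (\<lambda>v. f (D v))" by (rule endoI) (simp_all add: endoD[OF f] endoD[OF D(1)])
      ultimately show ?thesis
        by (simp add: linear_trace_eq_trace_on[OF B] trace_on_def)
    qed
    ultimately show ?thesis using D(1) by blast
  qed
  then show ?thesis using that B ev(1) by blast
qed

end

section \<open>Cyclicity of the trace, comparison of dimensions, rational functionals\<close>

lemma (in linear_operators) linear_trace_comm:
  assumes S: "finite S" "span S = UNIV" and f: "endo f" and g: "endo g"
  shows "linear_trace scale (\<lambda>v. f (g v)) = linear_trace scale (\<lambda>v. g (f v))"
proof -
  obtain B where B: "independent B" "UNIV \<subseteq> span B"
    using maximal_independent_subset[of UNIV] by blast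
  then have sB: "span B = UNIV" and fin: "finite B" using finite_independent[OF S] by auto
  have "endo (\<lambda>v. f (g v))" "endo (\<lambda>v. g (f v))"
    using f g by (auto intro!: endoI simp: endoD)
  then show ?thesis
    using trace_on_comm[OF fin B(1) fin B(1) g _ f] sB
    by (simp add: linear_trace_eq_trace_on[OF fin B(1) sB])
qed

lemma (in linear_operators) subspace_eq_of_dim_le:
  assumes S: "finite S" "span S = UNIV"
    and "subspace U" "subspace W" "U \<subseteq> W" "dim W \<le> dim U"
  shows "U = W"
proof -
  obtain B where B: "independent B" "UNIV \<subseteq> span B"
    using maximal_independent_subset[of UNIV] by blast
  then interpret finite_dimensional_vector_space scale B
    using finite_independent[OF S] by unfold_locales auto
  show ?thesis using assms by (intro subspace_dim_equal) auto
qed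

text \<open>The field is viewed as a vector space over the rationals, where a nonzero
  \<open>c\<close> is independent and the value 1 at \<open>c\<close> extends linearly.\<close>

lemma rational_functional:
  fixes c :: "'k::field_char_0"
  assumes "c \<noteq> 0"
  obtains \<phi> :: "'k \<Rightarrow> rat" where "\<And>x y. \<phi> (x + y) = \<phi> x + \<phi> y"
    "\<And>q x. \<phi> (of_rat q * x) = q * \<phi> x" "\<phi> c = 1"
proof -
  interpret vector_space_pair "\<lambda>q (x::'k). of_rat q * x" "(*) :: rat \<Rightarrow> rat \<Rightarrow> rat"
    by unfold_locales (simp_all add: algebra_simps of_rat_add of_rat_mult)
  have "vs1.independent {c}" using assms by simp
  from linear_independent_extend[OF this, of "\<lambda>_. 1"] obtain \<phi>
    where \<phi>: "Vector_Spaces.linear (\<lambda>q (x::'k). of_rat q * x) (*) \<phi>" "\<phi> c = 1" by auto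
  then interpret Vector_Spaces.linear "\<lambda>q (x::'k). of_rat q * x" "(*)" \<phi> by simp
  show ?thesis using that add scale \<phi>(2) by blast
qed

section \<open>The Killing form of a simple Lie algebra\<close>

lemma (in lie_algebra) br_skew: "br x y = - br y x"
proof -
  have "br (x + y) (x + y) = br x y + br y x"
    unfolding br_add_left br_add_right by (simp add: br_self)
  then show ?thesis by (simp add: br_self eq_neg_iff_add_eq_0)
qed

lemma (in lie_algebra) br_br: "br (br x y) z = br x (br y z) - br y (br x z)"
proof -
  have "br y (br z x) = - br y (br x z)"
    using br_skew[of z x] br_scale_right[of y "-1" "br x z"] by simp
  moreover have "br z (br x y) = - br (br x y) z" by (rule br_skew)
  ultimately show ?thesis using jacobi[of x y z] by (simp add: diff_diff_eq2 eq_diff_eq)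
qed

locale alg_closed_lie_algebra =
  fin_dim_simple_lie_algebra scale br + alg_closed_linear_operators scale
  for scale :: "'k::{alg_closed_field, field_char_0} \<Rightarrow> 'g::ab_group_add \<Rightarrow> 'g" and br
begin

lemma endo_br: "endo (br x)"
  by (rule endoI) (rule br_add_right br_scale_right)+

lemmas br_right = endoD[OF endo_br]

lemma br_left_zero: "br 0 x = 0" and br_left_diff: "br (x - z) y = br x y - br z y"
  using br_scale_left[of 0 0 x] br_scale_left[of "-1" z y] br_add_left[of x "-z" y] by simp_all

lemma br_derivation: "br x (br y z) = br (br x y) z + br y (br x z)"
  by (simp add: br_br)

lemma endo_comp: "endo f \<Longrightarrow> endo g \<Longrightarrow> endo (\<lambda>v. f (g v))"
  by (rule endoI) (simp_all add: endoD)

lemma linear_trace_diff: "linear_trace scale (\<lambda>z. f z - g z) = linear_trace scale f - linear_trace scale g"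
  using linear_trace_add[of f "\<lambda>z. - g z"] linear_trace_scale[of "-1" g] by simp

text \<open>Once \<open>ad\<close> of a bracket is written as a commutator, the two sides differ by
  a cyclic permutation under the trace.\<close>

lemma killing_invariant: "killing (br x y) z = killing x (br y z)"
proof -
  obtain S where S: "finite S" "span S = UNIV" using fin_dim by blast
  have "linear_trace scale (\<lambda>v. br y (br x (br z v))) = linear_trace scale (\<lambda>v. br x (br z (br y v)))"
    by (rule linear_trace_comm[OF S endo_br endo_comp[OF endo_br endo_br]])
  then show ?thesis
    unfolding killing_def br_br by (simp add: linear_trace_diff br_right)
qed

text \<open>The derived algebra is a nonzero ideal.\<close>

lemma perfect: "span {br x y |x y. True} = UNIV"
proof -
  have "lie_ideal (span {br x y |x y. True})"
    unfolding lie_ideal_def by (auto intro: span_base)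
  moreover have "span {br x y |x y. True} \<noteq> {0}"
    using nonabelian span_base[of _ "{br x y |x y. True}"] by blast
  ultimately show ?thesis using ideals_trivial by blast
qed

lemma perfect_induct:
  assumes "subspace U" "\<And>x y. br x y \<in> U" shows "x \<in> U"
  using perfect span_minimal[OF _ assms(1), of "{br x y |x y. True}"] assms(2) by auto

section \<open>The grading by generalized eigenspaces of \<open>ad x\<close>\<close>

text \<open>By the Leibniz rule, \<open>ad x - (c + d)\<close> maps \<open>br y z\<close> to a sum
  in which \<open>ad x - c\<close> hits \<open>y\<close> or \<open>ad x - d\<close> hits
  \<open>z\<close>; either way the sum of the two exponents drops.\<close>

lemma br_gen_eigenspace:
  assumes "y \<in> gen_eigenspace (br x) c" "z \<in> gen_eigenspace (br x) d"
  shows "br y z \<in> gen_eigenspace (br x) (c + d)"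
proof -
  have "(shift (br x) c ^^ i) y = 0 \<Longrightarrow> (shift (br x) d ^^ j) z = 0 \<Longrightarrow>
      br y z \<in> gen_eigenspace (br x) (c + d)" for i j y z
  proof (induction "i + j" arbitrary: i j y z rule: less_induct)
    case less
    note S = gen_eigenspace_subspace[OF endo_br, of x "c + d"]
    show ?case
    proof (cases "i = 0 \<or> j = 0")
      case True
      then have "br y z = 0" using less.prems by (auto simp: br_left_zero br_right)
      then show ?thesis using subspace_0[OF S] by simp
    next
      case False
      then obtain i' j' where ij: "i = Suc i'" "j = Suc j'" using not0_implies_Suc by blast
      have "br (shift (br x) c y) z \<in> gen_eigenspace (br x) (c + d)"
        using less.prems ij by (intro less.hyps[of i' j]) (simp_all add: funpow_swap1)
      moreover have "br y (shift (br x) d z) \<in> gen_eigenspace (br x) (c + d)"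
        using less.prems ij by (intro less.hyps[of i j']) (simp_all add: funpow_swap1)
      moreover have "shift (br x) (c + d) (br y z) = br (shift (br x) c y) z + br y (shift (br x) d z)"
        by (simp add: shift_def br_right br_left_diff br_scale_left scale_left_distrib
            br_derivation[of x y z])
      ultimately have "shift (br x) (c + d) (br y z) \<in> gen_eigenspace (br x) (c + d)"
        using subspace_add[OF S] by simp
      then show ?thesis by (simp add: shift_mem_gen_eigenspace_iff[OF endo_br])
    qed
  qed
  then show ?thesis using assms by (auto simp: gen_eigenspace_def)
qed

text \<open>Brackets add the eigenvalues, so on homogeneous elements the Leibniz rule is additivity
  of \<open>\<phi>\<close>; linearity in each argument does the rest.\<close>

lemma derivation_of_additive:
  assumes D: "endo D" "\<And>c v. v \<in> gen_eigenspace (br x) c \<Longrightarrow> D v = scale (\<phi> c) v"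
    and \<phi>: "\<And>c d. \<phi> (c + d) = \<phi> c + \<phi> d"
  shows "D (br y z) = br (D y) z + br y (D z)"
proof -
  obtain S where S: "finite S" "span S = UNIV" using fin_dim by blast
  let ?G = "\<Union>c. gen_eigenspace (br x) c"
  have G: "span ?G = UNIV" by (rule span_gen_eigenspaces[OF endo_br S])
  note L = endoD[OF D(1)] br_right br_add_left br_scale_left
  have 1: "D (br y z) = br (D y) z + br y (D z)"
    if "y \<in> gen_eigenspace (br x) c" "z \<in> gen_eigenspace (br x) d" for y z c d
    using D(2)[OF that(1)] D(2)[OF that(2)] D(2)[OF br_gen_eigenspace[OF that]]
    by (simp add: \<phi> L scale_left_distrib)
  have 2: "D (br y z) = br (D y) z + br y (D z)" if z: "z \<in> ?G" for y z
  proof -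
    have "subspace {y. D (br y z) = br (D y) z + br y (D z)}"
      by (rule subspaceI) (simp_all add: L br_left_zero scale_right_distrib ac_simps)
    then have "span ?G \<subseteq> {y. D (br y z) = br (D y) z + br y (D z)}"
      using 1 z by (intro span_minimal) blast+
    then show ?thesis using G by blast
  qed
  have "subspace {z. D (br y z) = br (D y) z + br y (D z)}"
    by (rule subspaceI) (simp_all add: L scale_right_distrib ac_simps)
  then have "span ?G \<subseteq> {z. D (br y z) = br (D y) z + br y (D z)}"
    using 2 by (intro span_minimal) blast+
  then show ?thesis using G by blast
qed

section \<open>Cartan's criterion and Engel's theorem\<close>

text \<open>For \<open>x = br y z\<close>, cyclicity and the Leibniz rule reduce the trace to
  \<open>- killing y (D z)\<close>; brackets span the algebra.\<close>

lemma trace_br_derivation: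
  assumes D: "endo D" "\<And>y z. D (br y z) = br (D y) z + br y (D z)"
    and K: "\<And>x y. killing x y = 0"
  shows "linear_trace scale (\<lambda>v. br x (D v)) = 0"
proof -
  obtain S where S: "finite S" "span S = UNIV" using fin_dim by blast
  have "linear_trace scale (\<lambda>v. br (br y z) (D v)) = 0" for y z
  proof -
    have "linear_trace scale (\<lambda>v. br (br y z) (D v)) =
      linear_trace scale (\<lambda>v. br y (br z (D v))) - linear_trace scale (\<lambda>v. br z (br y (D v)))"
      by (simp add: br_br linear_trace_diff)
    also have "linear_trace scale (\<lambda>v. br z (br y (D v))) = linear_trace scale (\<lambda>v. br y (D (br z v)))"
      by (rule linear_trace_comm[OF S endo_br endo_comp[OF endo_br D(1)]])
    also have "(\<lambda>v. br y (D (br z v))) = (\<lambda>v. br y (br (D z) v) + br y (br z (D v)))"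
      by (simp add: D(2) br_right)
    also have "linear_trace scale \<dots> = killing y (D z) + linear_trace scale (\<lambda>v. br y (br z (D v)))"
      by (simp add: linear_trace_add killing_def)
    finally show ?thesis using K by simp
  qed
  moreover have "linear_trace scale (\<lambda>v. 0) = 0" using linear_trace_scale[of 0 id] by simp
  then have "subspace {x. linear_trace scale (\<lambda>v. br x (D v)) = 0}"
    by (intro subspaceI)
      (simp_all add: br_left_zero br_add_left br_scale_left linear_trace_add linear_trace_scale)
  ultimately show ?thesis using perfect_induct[of "{x. linear_trace scale (\<lambda>v. br x (D v)) = 0}" x] by blast
qed

text \<open>
  If the eigenvalues \<open>c\<close> of \<open>ad x\<close> were not all zero, a rational-linear \<open>\<phi>\<close> would make the trace
  \<open>\<Sum> \<phi> c * c\<close> of \<open>ad x \<circ> D\<close>, to which \<open>\<phi>\<close> is applied once more, a nonzero sum of squares.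
\<close>

lemma killing_zero_imp_ad_nilpotent:
  assumes K: "\<And>x y. killing x y = 0"
  shows "\<exists>n. (br x ^^ n) y = 0"
proof -
  obtain S where S: "finite S" "span S = UNIV" using fin_dim by blast
  obtain B ev where B: "finite B" "span B = UNIV" "\<And>b. b \<in> B \<Longrightarrow> b \<in> gen_eigenspace (br x) (ev b)"
    "\<And>\<phi>. \<exists>D. endo D \<and> (\<forall>c. \<forall>v\<in>gen_eigenspace (br x) c. D v = scale (\<phi> c) v) \<and>
      linear_trace scale (\<lambda>v. br x (D v)) = (\<Sum>b\<in>B. \<phi> (ev b) * ev b)"
    by (rule gen_eigenspace_operator[OF endo_br[of x] S]) (rule that)
  have "ev b = 0" if b: "b \<in> B" for b
  proof (rule ccontr)
    assume "ev b \<noteq> 0"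
    then obtain \<phi> :: "'k \<Rightarrow> rat" where \<phi>: "\<And>x y. \<phi> (x + y) = \<phi> x + \<phi> y"
        "\<And>q x. \<phi> (of_rat q * x) = q * \<phi> x" "\<phi> (ev b) = 1"
      by (rule rational_functional) blast
    obtain D where D: "endo D" "\<And>c v. v \<in> gen_eigenspace (br x) c \<Longrightarrow> D v = scale (of_rat (\<phi> c)) v"
      "linear_trace scale (\<lambda>v. br x (D v)) = (\<Sum>b\<in>B. of_rat (\<phi> (ev b)) * ev b)"
      using B(4)[of "\<lambda>c. of_rat (\<phi> c)"] by blast
    have "D (br y z) = br (D y) z + br y (D z)" for y z
      using derivation_of_additive[OF D(1,2)] by (simp add: \<phi>(1) of_rat_add)
    then have sum0: "(\<Sum>b\<in>B. of_rat (\<phi> (ev b)) * ev b) = 0"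
      using trace_br_derivation[OF D(1) _ K] D(3) by simp
    have \<phi>0: "\<phi> 0 = 0" using \<phi>(1)[of 0 0] by simp
    have "\<phi> (\<Sum>b\<in>A. of_rat (\<phi> (ev b)) * ev b) = (\<Sum>b\<in>A. \<phi> (ev b) * \<phi> (ev b))"
      if "finite A" for A :: "'g set"
      using that by (induction A rule: finite_induct) (simp_all add: \<phi>(1,2) \<phi>0)
    then have "(\<Sum>b\<in>B. \<phi> (ev b) * \<phi> (ev b)) = 0" using B(1) sum0 \<phi>0 by metis
    then have "\<phi> (ev b) * \<phi> (ev b) = 0"
      using b B(1) by (subst (asm) sum_nonneg_eq_0_iff) auto
    then show False using \<phi>(3) by simp
  qed
  then have "B \<subseteq> gen_eigenspace (br x) 0" using B(3) by force
  then have "y \<in> gen_eigenspace (br x) 0"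
    using span_minimal[OF _ gen_eigenspace_subspace[OF endo_br]] B(2) by blast
  moreover have "shift (br x) 0 = br x" by (simp add: shift_def fun_eq_iff)
  ultimately show ?thesis by (simp add: gen_eigenspace_def)
qed

text \<open>
  Engel's theorem for the nilpotent \<open>H\<close> acting on the quotient by \<open>H\<close>: a minimal \<open>H\<close>-invariant
  subspace above \<open>H\<close> is mapped into \<open>H\<close> by each term of the lower central series, the last first,
  hence lies in the normalizer.
\<close>

lemma exists_ad_not_nilpotent:
  assumes H: "cartan_subalgebra H"
  shows "\<exists>x y. \<forall>n. (br x ^^ n) y \<noteq> 0"
proof (rule ccontr)
  assume "\<nexists>x y. \<forall>n. (br x ^^ n) y \<noteq> 0"
  then have nil: "\<exists>n. (br x ^^ n) y = 0" for x y by blast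
  obtain S where S: "finite S" "span S = UNIV" using fin_dim by blast
  have sub: "subspace H" "\<And>x y. x \<in> H \<Longrightarrow> y \<in> H \<Longrightarrow> br x y \<in> H"
    and norm: "normalizer H = H"
    using H by (auto simp: cartan_subalgebra_def lie_subalgebra_def)
  obtain N where N: "lower_central H N = {0}" using H by (auto simp: cartan_subalgebra_def)
  \<comment> \<open>The lower central series of a perfect algebra is constant, so it cannot reach
    \<open>{0}\<close>.\<close>
  have "H \<noteq> UNIV"
  proof
    assume "H = UNIV"
    then have "lower_central H n = UNIV" for n by (induction n) (simp_all add: perfect[simplified])
    then have "(UNIV :: 'g set) = {0}" using N by simp
    then show False using nonabelian by blast
  qed
  have lcH: "lower_central H n \<subseteq> H" for n
  proof (induction n)
    case (Suc n)
    then have "{br x y |x y. x \<in> H \<and> y \<in> lower_central H n} \<subseteq> H" using sub(2) by blast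
    then show ?case by (simp add: span_minimal sub(1))
  qed simp
  define Q where "Q U \<longleftrightarrow> subspace U \<and> H \<subset> U \<and> (\<forall>h\<in>H. \<forall>u\<in>U. br h u \<in> U)" for U
  have "Q UNIV" using \<open>H \<noteq> UNIV\<close> by (auto simp: Q_def)
  then obtain U where U: "Q U" and min: "\<And>W. Q W \<Longrightarrow> dim U \<le> dim W"
    using ex_has_least_nat[of Q UNIV dim] by blast
  have "\<forall>z\<in>lower_central H 0. \<forall>u\<in>U. br z u \<in> H"
  proof (rule inc_induct[of 0 N])
    show "\<forall>z\<in>lower_central H N. \<forall>u\<in>U. br z u \<in> H"
      using subspace_0[OF sub(1)] by (simp add: N br_left_zero)
    fix n assume IH: "\<forall>z\<in>lower_central H (Suc n). \<forall>u\<in>U. br z u \<in> H"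
    show "\<forall>z\<in>lower_central H n. \<forall>u\<in>U. br z u \<in> H"
    proof
      fix z assume z: "z \<in> lower_central H n"
      then have zH: "z \<in> H" using lcH by blast
      \<comment> \<open>By minimality of \<open>U\<close>, it is enough that \<open>W\<close> is
        \<open>H\<close>-invariant and strictly larger than \<open>H\<close>.\<close>
      define W where "W = {v \<in> U. br z v \<in> H}"
      have "Q W"
        unfolding Q_def
      proof (intro conjI ballI)
        have "subspace (U \<inter> {v. br z v \<in> H})"
          using U endo_subspace_vimage[OF endo_br sub(1)] by (auto simp: Q_def intro: subspace_inter)
        then show "subspace W" by (simp add: W_def Int_def)
        obtain v where v: "v \<in> U" "v \<notin> H" using U by (auto simp: Q_def)
        \<comment> \<open>Nilpotency of \<open>ad z\<close> enters here: the last iterate of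
          \<open>v\<close> outside \<open>H\<close> is an element of \<open>W\<close> not in
          \<open>H\<close>.\<close>
        obtain m where "(br z ^^ m) v = 0" using nil by blast
        then have "(br z ^^ m) v \<in> H" using subspace_0[OF sub(1)] by simp
        then obtain i where i: "(br z ^^ i) v \<notin> H" "(br z ^^ Suc i) v \<in> H"
          using v(2) by (induction m) auto
        have "(br z ^^ i) v \<in> U" by (induction i) (use U v zH in \<open>auto simp: Q_def\<close>)
        then have "(br z ^^ i) v \<in> W" using i by (simp add: W_def)
        moreover have "H \<subseteq> W" using U zH sub(2) by (auto simp: W_def Q_def)
        ultimately show "H \<subset> W" using i(1) by blast
        fix h v assume h: "h \<in> H" and v: "v \<in> W"
        \<comment> \<open>\<open>br h z\<close> lies one term further down the series, where the
          induction hypothesis applies.\<close>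
        have "br h z \<in> lower_central H (Suc n)" using h z by (auto intro: span_base)
        then have "br (br h z) v \<in> H" using IH v by (auto simp: W_def)
        moreover have "br h (br z v) \<in> H" using v h sub(2) by (simp add: W_def)
        ultimately have "br z (br h v) \<in> H"
          using subspace_diff[OF sub(1)] by (simp add: br_derivation[of h z v]) (metis add_diff_cancel_left')
        then show "br h v \<in> W" using U h v by (auto simp: W_def Q_def)
      qed
      then have "W = U"
        using min U by (intro subspace_eq_of_dim_le[OF S]) (auto simp: Q_def W_def)
      then show "\<forall>u\<in>U. br z u \<in> H" by (auto simp: W_def)
    qed
  qed simp
  then have "U \<subseteq> normalizer H"
    using subspace_neg[OF sub(1)] by (auto simp: normalizer_def) (metis br_skew)
  then show False using norm U by (auto simp: Q_def)
qed

text \<open>A zero form would make every \<open>ad x\<close> nilpotent, which is incompatible with a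
  Cartan subalgebra.\<close>

lemma killing_nonzero:
  assumes "cartan_subalgebra H"
  shows "\<exists>x y. killing x y \<noteq> 0"
  using exists_ad_not_nilpotent[OF assms] killing_zero_imp_ad_nilpotent by blast

section \<open>The Killing form on a Cartan subalgebra\<close>

text \<open>Modulo the images of the \<open>ad h\<close>, which are orthogonal to \<open>H\<close>,
  every \<open>y\<close> can be moved into the centralizer of \<open>H\<close>, hence into
  \<open>normalizer H = H\<close>. A form vanishing on \<open>H\<close> would therefore put
  \<open>H\<close> into the radical, which is zero.\<close>

lemma killing_nonzero_on_cartan:
  assumes H: "cartan_subalgebra H" and ab: "\<And>h h'. h \<in> H \<Longrightarrow> h' \<in> H \<Longrightarrow> br h h' = 0"
    and ss: "\<And>h y. h \<in> H \<Longrightarrow> br h (br h y) = 0 \<Longrightarrow> br h y = 0"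
  shows "\<exists>h\<in>H. \<exists>h'\<in>H. killing h h' \<noteq> 0"
proof (rule ccontr)
  assume "\<not> ?thesis"
  then have K0: "killing h h' = 0" if "h \<in> H" "h' \<in> H" for h h' using that by blast
  obtain S where S: "finite S" "span S = UNIV" using fin_dim by blast
  have norm: "normalizer H = H" and subH: "subspace H"
    using H by (auto simp: cartan_subalgebra_def lie_subalgebra_def)
  obtain C where C: "C \<subseteq> H" "independent C" "H \<subseteq> span C"
    using maximal_independent_subset[of H] by blast
  have "finite C" using finite_independent[OF S C(2)] .
  \<comment> \<open>Removes from \<open>y\<close>, for one generator of \<open>H\<close> after
    another, its part in the image of \<open>ad g\<close>, without changing the values
    \<open>killing h y\<close>.\<close>
  have red: "\<exists>y'. (\<forall>h\<in>F. br h y' = 0) \<and> (\<forall>h\<in>H. killing h y = killing h y')"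
    if "finite F" "F \<subseteq> H" for F y
    using that
  proof (induction F rule: finite_induct)
    case (insert g F)
    then obtain y' where y': "\<forall>h\<in>F. br h y' = 0" "\<forall>h\<in>H. killing h y = killing h y'" by auto
    have g: "g \<in> H" using insert by blast
    obtain u w where uw: "y' = br g u + w" "br g w = 0"
      using fitting_decomposition[OF endo_br S ss[OF g]] by blast
    have "br h w = 0" if h: "h \<in> F" for h
    proof -
      have comm: "br h (br g v) = br g (br h v)" for v
        using br_derivation[of h g v] ab[of h g] h g insert.prems by (auto simp: br_left_zero)
      have "br g (br h u) + br h w = 0" using y'(1) h uw(1) comm by (metis br_right(1))
      \<comment> \<open>\<open>br h w\<close> lies in the image and in the kernel of
        \<open>ad g\<close>; semisimplicity makes that intersection zero, so the generators treated
        earlier are not disturbed.\<close>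
      then have hw: "br h w = - br g (br h u)" by (simp add: eq_neg_iff_add_eq_0 add.commute)
      moreover have "br g (br h w) = 0" using comm[of w] uw(2) by (simp add: br_right)
      ultimately have "br g (br g (br h u)) = 0" by (simp add: br_right)
      then show ?thesis using ss[OF g] hw by simp
    qed
    moreover have "killing h y = killing h w" if "h \<in> H" for h
    proof -
      have "killing h (br g u) = killing (br h g) u" by (simp add: killing_invariant)
      also have "\<dots> = 0" using ab[OF that g] killing_scale_left[of 0 0 u] by simp
      finally show ?thesis using y'(2) that uw(1) by (simp add: killing_add_right)
    qed
    ultimately show ?case using uw(2) by blast
  qed blast
  have KH: "killing h y = 0" if h: "h \<in> H" for h y
  proof -
    obtain y' where y': "\<forall>h\<in>C. br h y' = 0" "\<forall>h\<in>H. killing h y = killing h y'"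
      using red[OF \<open>finite C\<close> C(1)] by blast
    have "subspace {h. br h y' = 0}"
      by (rule subspaceI) (simp_all add: br_left_zero br_add_left br_scale_left)
    then have "br h y' = 0" if "h \<in> H" for h
      using span_minimal[of C "{h. br h y' = 0}"] y'(1) C(3) that by blast
    then have "br y' h = 0" if "h \<in> H" for h using that br_skew[of y' h] by simp
    then have "y' \<in> normalizer H" using subspace_0[OF subH] by (simp add: normalizer_def)
    then show ?thesis using y'(2) h K0 norm by simp
  qed
  define R where "R = {x. \<forall>y. killing x y = 0}"
  have "lie_ideal R"
    unfolding lie_ideal_def
  proof (intro conjI allI ballI)
    show "subspace R"
      unfolding R_def using killing_scale_left[of 0 0]
      by (intro subspaceI) (simp_all add: killing_add_left killing_scale_left)
    fix x y assume y: "y \<in> R"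
    have "killing (br y x) z = 0" for z using y by (simp add: killing_invariant R_def)
    then have "killing (br x y) z = 0" for z
      using br_skew[of x y] killing_scale_left[of "-1" "br y x" z] by simp
    then show "br x y \<in> R" by (simp add: R_def)
  qed
  moreover have "R \<noteq> UNIV" using killing_nonzero[OF H] by (auto simp: R_def)
  ultimately have "R = {0}" using ideals_trivial by blast
  then have "H \<subseteq> {0}" using KH by (auto simp: R_def)
  then have "H = {0}" using subspace_0[OF subH] by blast
  \<comment> \<open>Everything normalizes \<open>{0}\<close>.\<close>
  then have "UNIV = H" using norm by (auto simp: normalizer_def br_right)
  then show False using nonabelian \<open>H = {0}\<close> by blast
qed

end

section \<open>Simple weight modules\<close>

lemma is_direct_sum_decomposition:
  assumes "is_direct_sum I W"
  obtains F f where "finite F" "F \<subseteq> I" "\<And>i. i \<in> F \<Longrightarrow> f i \<in> W i" "v = (\<Sum>i\<in>F. f i)"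
proof -
  obtain f where f: "finite {i. f i \<noteq> 0}" "{i. f i \<noteq> 0} \<subseteq> I" "\<forall>i\<in>I. f i \<in> W i"
      "v = (\<Sum>i\<in>{i. f i \<noteq> 0}. f i)"
    using ex1_implies_ex[OF assms[unfolded is_direct_sum_def, THEN spec, of v]]
    by (elim exE conjE) (rule that)
  show ?thesis
  proof (rule that[OF f(1,2) _ f(4)])
    show "f i \<in> W i" if "i \<in> {i. f i \<noteq> 0}" for i using f(2,3) that by blast
  qed
qed

text \<open>Uniqueness for the vector 0: \<open>f\<close>, extended by zero outside
  \<open>F\<close>, is compared with the zero family. As the \<open>W i\<close> are arbitrary sets,
  \<open>0 \<in> W i\<close> has to be assumed.\<close>

lemma is_direct_sum_zero:
  assumes "is_direct_sum I W" "\<And>i. i \<in> I \<Longrightarrow> 0 \<in> W i"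
    and F: "finite F" "F \<subseteq> I" "\<And>i. i \<in> F \<Longrightarrow> f i \<in> W i" "(\<Sum>i\<in>F. f i) = 0" and "i \<in> F"
  shows "f i = 0"
proof -
  define P where "P g \<longleftrightarrow> finite {i. g i \<noteq> 0} \<and> {i. g i \<noteq> 0} \<subseteq> I \<and> (\<forall>i\<in>I. g i \<in> W i) \<and>
    0 = (\<Sum>i\<in>{i. g i \<noteq> 0}. g i)" for g
  define g where "g i = (if i \<in> F then f i else 0)" for i
  have ex1: "\<exists>!g. P g"
    unfolding P_def by (rule assms(1)[unfolded is_direct_sum_def, THEN spec])
  have supp: "{i. g i \<noteq> 0} \<subseteq> F" by (auto simp: g_def)
  have "(\<Sum>i\<in>{i. g i \<noteq> 0}. g i) = (\<Sum>i\<in>F. g i)"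
    using F(1) supp by (intro sum.mono_neutral_left) auto
  also have "\<dots> = 0" using F(4) by (simp add: g_def)
  finally have "P g"
    using supp F(1,2,3) assms(2) finite_subset[OF supp F(1)] by (auto simp: P_def g_def)
  moreover have "P (\<lambda>_. 0)" using assms(2) by (simp add: P_def)
  ultimately have "g = (\<lambda>_. 0)" using ex1 by blast
  then have "g i = 0" by simp
  then show ?thesis using \<open>i \<in> F\<close> by (simp add: g_def)
qed

text \<open>The record has no subtraction, so \<open>x - w\<close> is expressed through the scalar
  -1.\<close>

lemma (in vspace_on) vcoset_absorb:
  assumes W: "vsubspace V W" and w: "w \<in> W"
  shows "vcoset V W w = W"
proof
  note WD = W_mem[OF W]
  show "vcoset V W w \<subseteq> W" using w WD(3) by (auto simp: vcoset_def)
  show "W \<subseteq> vcoset V W w"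
  proof
    fix x assume x: "x \<in> W"
    note m = WD(1)[OF x] WD(1)[OF w] scale_mem[OF WD(1)[OF w]]
    have "vadd V w (vscale V (- 1) w) = vadd V (vscale V 1 w) (vscale V (- 1) w)"
      using m by (simp add: scale_one)
    also have "\<dots> = vzero V" using m by (simp add: add_scale[symmetric] scale_zero)
    finally have "vadd V w (vadd V x (vscale V (- 1) w)) = x"
      using m by (simp add: add_left_comm[of w x] add_zero)
    moreover have "vadd V x (vscale V (- 1) w) \<in> W" using x w WD(3,4) by simp
    ultimately show "x \<in> vcoset V W w" unfolding vcoset_def by force
  qed
qed

lemma tensor_linear:
  "tensor sA sB (x + y) a = vadd (tensor_space sA sB) (tensor sA sB x a) (tensor sA sB y a)"
  "tensor sA sB (sA c x) a = vscale (tensor_space sA sB) c (tensor sA sB x a)"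
  using kernel_intros(1)[of x y a sA sB] kernel_intros(3)[of sA c x a sB]
  by (auto simp: tensor_def tensor_space_rules intro!: tensor_class_eqI simp: diff_diff_eq)

lemma central_class_kernel:
  assumes "A \<in> central_kernel sS"
  shows "central_class sS A = vzero (central_space sS)"
  using vspace_on.vcoset_absorb[OF vspace_on_tensor vsubspace_central_kernel assms]
  by (simp add: central_class_def central_space_def vquot_def)

lemma central_symbol_relations:
  fixes sS :: "'k::field \<Rightarrow> 's::{comm_ring, comm_monoid_mult} \<Rightarrow> 's"
  defines "C \<equiv> central_space sS" and "c \<equiv> central_symbol sS"
  shows "vadd C (c r s) (c s r) = vzero C"
    and "vadd C (vadd C (c (r * s) u) (c (s * u) r)) (c (u * r) s) = vzero C"
proof -
  let ?T = "tensor_space sS sS" and ?t = "tensor sS sS"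
  have t: "?t r s \<in> carr ?T" for r s by (simp add: tensor_def tensor_space_rules)
  have rel: "cyclic_relations sS \<subseteq> central_kernel sS"
    unfolding central_kernel_def
    by (rule vspace_on.vsubspace_vspan(2)[OF vspace_on_tensor])
      (auto simp: cyclic_relations_def Let_def tensor_def tensor_space_rules)
  have "vadd ?T (?t r s) (?t s r) \<in> cyclic_relations sS"
    unfolding cyclic_relations_def Let_def by blast
  then have "central_class sS (vadd ?T (?t r s) (?t s r)) = vzero C"
    unfolding C_def using rel central_class_kernel by blast
  then show "vadd C (c r s) (c s r) = vzero C"
    by (simp add: C_def c_def central_symbol_def central_space_rules t)
  have "vadd ?T (vadd ?T (?t (r * s) u) (?t (s * u) r)) (?t (u * r) s) \<in> cyclic_relations sS"
    unfolding cyclic_relations_def Let_def by blast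
  then have "central_class sS (vadd ?T (vadd ?T (?t (r * s) u) (?t (s * u) r)) (?t (u * r) s)) = vzero C"
    unfolding C_def using rel central_class_kernel by blast
  then show "vadd C (vadd C (c (r * s) u) (c (s * u) r)) (c (u * r) s) = vzero C"
    by (simp add: C_def c_def central_symbol_def central_space_rules t vspace_on.add_mem[OF vspace_on_tensor])
qed

section \<open>Operators of the central extension on a simple module\<close>

locale uce_simple_module =
  g: alg_closed_lie_algebra sg br + S: comm_algebra sS + V: alg_closed_linear_operators sV +
  M: simple_lie_module sV "uce_space sg sS" "uce_bracket sg br sS" act
  for sg :: "'k::{alg_closed_field, field_char_0} \<Rightarrow> 'g::ab_group_add \<Rightarrow> 'g" and br
    and sS :: "'k \<Rightarrow> 's::{comm_ring, comm_monoid_mult} \<Rightarrow> 's"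
    and sV :: "'k \<Rightarrow> 'v::ab_group_add \<Rightarrow> 'v" and act :: "('k, 'g, 's) uce \<Rightarrow> 'v \<Rightarrow> 'v"
begin

definition T :: "'g \<Rightarrow> 's \<Rightarrow> 'v \<Rightarrow> 'v" where
  "T x a = act (tensor sg sS x a, vzero (central_space sS))"

definition Z :: "'s \<Rightarrow> 's \<Rightarrow> 'v \<Rightarrow> 'v" where
  "Z a b = act (vzero (tensor_space sg sS), central_symbol sS a b)"

lemma mem_spaces:
  "tensor sA sB x a \<in> carr (tensor_space sA sB)" "vzero (tensor_space sA sB) \<in> carr (tensor_space sA sB)"
  "central_symbol sS a b \<in> carr (central_space sS)" "vzero (central_space sS) \<in> carr (central_space sS)"
  by (auto simp: tensor_def central_symbol_def central_space_rules tensor_space_rules)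

lemma uce_rules:
  "carr (uce_space sg sS) = carr (tensor_space sg sS) \<times> carr (central_space sS)"
  "vadd (uce_space sg sS) (p, q) (p', q') =
    (vadd (tensor_space sg sS) p p', vadd (central_space sS) q q')"
  "vscale (uce_space sg sS) c (p, q) = (vscale (tensor_space sg sS) c p, vscale (central_space sS) c q)"
  by (simp_all add: uce_space_def vdsum_def)

lemmas zero_rules =
  vspace_on.add_zero[OF vspace_on_tensor] vspace_on.add_zero[OF vspace_on_central]
  vspace_on.scale_zero[OF vspace_on_tensor] vspace_on.scale_zero[OF vspace_on_central]

lemma vscale_vzero:
  "vscale (tensor_space sA sB) c (vzero (tensor_space sA sB)) = vzero (tensor_space sA sB)"
  "vscale (central_space sS) c (vzero (central_space sS)) = vzero (central_space sS)"
  by (simp_all add: central_space_rules tensor_space_rules free.scale_zero_right)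

lemma endo_act: "X \<in> carr (uce_space sg sS) \<Longrightarrow> V.endo (act X)"
  by (rule V.endoI) (simp_all add: M.act_add M.act_scale)

lemma endo_T: "V.endo (T x a)" and endo_Z: "V.endo (Z a b)"
  by (simp_all add: T_def Z_def endo_act uce_rules mem_spaces)

lemma act_zero: "act (vzero (tensor_space sg sS), vzero (central_space sS)) v = 0"
  using M.act_vscale[of "(vzero (tensor_space sg sS), vzero (central_space sS))" 0 v]
  by (simp add: uce_rules mem_spaces vscale_vzero)

lemma T_add: "T (x + y) a v = T x a v + T y a v"
  using M.act_vadd[of "(tensor sg sS x a, vzero (central_space sS))"
      "(tensor sg sS y a, vzero (central_space sS))" v]
  by (simp add: T_def uce_rules mem_spaces zero_rules tensor_linear)

lemma T_scale: "T (sg c x) a v = sV c (T x a v)"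
  using M.act_vscale[of "(tensor sg sS x a, vzero (central_space sS))" c v]
  by (simp add: T_def uce_rules mem_spaces vscale_vzero tensor_linear)

lemma T_zero: "T 0 a v = 0"
  using T_scale[of 0 0 a v] by simp

lemma T_commutator: "T x a (T y b v) - T y b (T x a v) = T (br x y) (a * b) v + sV (g.killing x y) (Z a b v)"
proof -
  let ?L = "uce_space sg sS" and ?X = "\<lambda>x a. (tensor sg sS x a, vzero (central_space sS))"
    and ?C = "(vzero (tensor_space sg sS), central_symbol sS a b)"
  have 0: "tensor sg sS x a = tensor_class sg sS (free_gen x a)" for x a by (simp add: tensor_def)
  have "uce_bracket sg br sS (?X x a) (?X y b) =
      (tensor sg sS (br x y) (a * b), vscale (central_space sS) (g.killing x y) (central_symbol sS a b))"
    unfolding 0 g.uce_bracket_class[OF S.comm_algebra_axioms]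
    by (simp add: central_symbol_def tensor_def central_space_rules tensor_space_rules)
  also have "\<dots> = vadd ?L (?X (br x y) (a * b)) (vscale ?L (g.killing x y) ?C)"
    using vspace_on.scale_mem[OF vspace_on_central mem_spaces(3), of "g.killing x y" a b]
    by (simp add: uce_rules vscale_vzero zero_rules mem_spaces
        vspace_on.add_comm[OF vspace_on_central mem_spaces(4)])
  finally have *: "uce_bracket sg br sS (?X x a) (?X y b) =
    vadd ?L (?X (br x y) (a * b)) (vscale ?L (g.killing x y) ?C)" .
  have X: "?X x a \<in> carr ?L" "?C \<in> carr ?L" for x a by (simp_all add: uce_rules mem_spaces)
  have "vscale ?L (g.killing x y) ?C \<in> carr ?L"
    by (rule vspace_on.scale_mem[OF vspace_on_uce X(2)])
  then show ?thesis
    using M.act_bracket[OF X(1) X(1), of x a y b v] M.act_vadd[OF X(1)] M.act_vscale[OF X(2)]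
    by (simp add: T_def Z_def *)
qed

lemma Z_central:
  assumes X: "X \<in> carr (uce_space sg sS)"
  shows "act X (Z a b v) = Z a b (act X v)"
proof -
  obtain p A where XA: "X = (tensor_class sg sS p, A)"
    using X by (cases X) (auto simp: uce_rules tensor_space_rules)
  \<comment> \<open>The zero class has the representative 0, for which both bilinear extensions are
    empty sums.\<close>
  have "uce_bracket sg br sS X (vzero (tensor_space sg sS), central_symbol sS a b) =
      (vzero (tensor_space sg sS), vzero (central_space sS))"
    unfolding XA tensor_space_rules g.uce_bracket_class[OF S.comm_algebra_axioms]
    by (simp add: bilinear_ext_def central_space_rules tensor_space_rules)
  then show ?thesis
    using M.act_bracket[OF X, of "(vzero (tensor_space sg sS), central_symbol sS a b)" v] act_zero
    by (simp add: Z_def uce_rules mem_spaces)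
qed

text \<open>Skew symmetry makes \<open>Z 1 a + Z a 1\<close> vanish, and the cyclic relation for 1,
  1, \<open>a\<close> makes \<open>Z 1 a\<close> plus twice \<open>Z a 1\<close> vanish.
  Consequently commutators with \<open>T x 1\<close> have no central term.\<close>

lemma Z_one_left: "Z 1 a v = 0"
proof -
  let ?c = "\<lambda>a b. (vzero (tensor_space sg sS), central_symbol sS a b)"
  have m: "?c a b \<in> carr (uce_space sg sS)" for a b by (simp add: uce_rules mem_spaces)
  have add: "act (vadd (uce_space sg sS) X (?c a b)) v = act X v + Z a b v"
    if "X \<in> carr (uce_space sg sS)" for X a b
    by (simp add: Z_def M.act_vadd[OF that m])
  have skew: "Z 1 a v + Z a 1 v = 0"
    using add[OF m, of 1 a a 1]
    by (simp add: uce_rules zero_rules mem_spaces central_symbol_relations act_zero)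
      (simp add: Z_def)
  moreover have "Z 1 a v + Z a 1 v + Z a 1 v = 0"
  proof -
    have "vadd (uce_space sg sS) (?c 1 a) (?c a 1) \<in> carr (uce_space sg sS)"
      by (rule vspace_on.add_mem[OF vspace_on_uce m m])
    from add[OF this, of a 1] show ?thesis
      using central_symbol_relations(2)[of sS 1 1 a] add[OF m, of 1 a a 1]
      by (simp add: uce_rules zero_rules mem_spaces act_zero) (simp add: Z_def)
  qed
  ultimately show ?thesis by (metis add.right_neutral add_0_left add.assoc)
qed

end

section \<open>Weight spaces and the vanishing of the central operators\<close>

locale uce_simple_weight_module = uce_simple_module sg br sS sV act
  for sg :: "'k::{alg_closed_field, field_char_0} \<Rightarrow> 'g::ab_group_add \<Rightarrow> 'g" and br
    and sS :: "'k \<Rightarrow> 's::{comm_ring, comm_monoid_mult} \<Rightarrow> 's"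
    and sV :: "'k \<Rightarrow> 'v::ab_group_add \<Rightarrow> 'v" and act +
  fixes H :: "'g set"
  assumes cartan: "g.cartan_subalgebra H" and weight: "uce_weight_module sg sS sV act H"
begin

abbreviation "wt \<equiv> uce_weight_space sg sS sV act H"

lemma mem_wt: "v \<in> wt \<mu> \<longleftrightarrow> (\<forall>h\<in>H. T h 1 v = sV (\<mu> h) v)"
  by (simp add: uce_weight_space_def T_def)

lemma direct: "is_direct_sum (dual_space sg H) wt"
  using weight by (simp add: uce_weight_module_def)

lemma subspace_wt: "V.subspace (wt \<mu>)"
  by (rule V.subspaceI)
    (simp_all add: mem_wt V.endoD[OF endo_T] V.scale_right_distrib mult.commute)

lemma eq_zero_on_weight_spaces:
  assumes f: "V.endo f" and "\<And>\<mu> v. \<mu> \<in> dual_space sg H \<Longrightarrow> v \<in> wt \<mu> \<Longrightarrow> f v = 0"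
  shows "f v = 0"
proof -
  obtain F x where F: "finite F" "F \<subseteq> dual_space sg H" "\<And>\<mu>. \<mu> \<in> F \<Longrightarrow> x \<mu> \<in> wt \<mu>" "v = (\<Sum>\<mu>\<in>F. x \<mu>)"
    using is_direct_sum_decomposition[OF direct, of v] by blast
  have "f (x \<mu>) = 0" if "\<mu> \<in> F" for \<mu> using assms(2) F(2,3) that by blast
  then show ?thesis by (simp add: F(4) V.endoD(6)[OF f])
qed

text \<open>The shifted operator is a scalar on each weight component, and a scalar whose square
  kills a vector kills the vector; directness of the sum separates the components.\<close>

lemma T_semisimple:
  assumes h: "h \<in> H" and v: "V.shift (T h 1) c (V.shift (T h 1) c v) = 0"
  shows "V.shift (T h 1) c v = 0"
proof -
  let ?s = "V.shift (T h 1) c"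
  note L = V.endo_shift[OF endo_T, of h 1 c]
  obtain F x where F: "finite F" "F \<subseteq> dual_space sg H" "\<And>\<mu>. \<mu> \<in> F \<Longrightarrow> x \<mu> \<in> wt \<mu>" "v = (\<Sum>\<mu>\<in>F. x \<mu>)"
    using is_direct_sum_decomposition[OF direct, of v] by blast
  have s: "?s (x \<mu>) = sV (\<mu> h - c) (x \<mu>)" if "\<mu> \<in> F" for \<mu>
    using F(3)[OF that] h by (simp add: mem_wt V.shift_def V.scale_left_diff_distrib)
  have ss: "?s (?s (x \<mu>)) = 0" if \<mu>: "\<mu> \<in> F" for \<mu>
  proof (rule is_direct_sum_zero[OF direct _ F(1,2) _ _ \<mu>])
    show "0 \<in> wt \<mu>" for \<mu> using V.subspace_0[OF subspace_wt] .
    show "?s (?s (x \<mu>)) \<in> wt \<mu>" if "\<mu> \<in> F" for \<mu>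
      using F(3)[OF that] s[OF that] by (simp add: V.endoD(2)[OF L] V.subspace_scale[OF subspace_wt])
    show "(\<Sum>\<mu>\<in>F. ?s (?s (x \<mu>))) = 0"
      using v by (simp add: F(4) V.endoD(6)[OF L])
  qed
  have "?s (x \<mu>) = 0" if "\<mu> \<in> F" for \<mu>
  proof -
    have "?s (?s (x \<mu>)) = sV (\<mu> h - c) (?s (x \<mu>))"
      by (subst s[OF that]) (rule V.endoD(2)[OF L])
    then have "\<mu> h - c = 0 \<or> ?s (x \<mu>) = 0" using ss[OF that] by simp
    then show ?thesis using s[OF that] by auto
  qed
  then show ?thesis by (simp add: F(4) V.endoD(6)[OF L])
qed

lemma nonzero_weight_space:
  obtains \<mu> B where "V.independent B" "finite B" "B \<noteq> {}" "V.span B = wt \<mu>"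
proof -
  obtain v :: 'v where v: "v \<noteq> 0" using M.nonzero by blast
  have "\<exists>\<mu>\<in>dual_space sg H. \<exists>u\<in>wt \<mu>. u \<noteq> 0"
    using eq_zero_on_weight_spaces[OF V.linear_ident, of v] v by blast
  then obtain \<mu> u where \<mu>: "\<mu> \<in> dual_space sg H" "u \<in> wt \<mu>" "u \<noteq> 0" by blast
  obtain B0 where B0: "finite B0" "V.span B0 = wt \<mu>"
    using weight \<mu>(1) by (auto simp: uce_weight_module_def)
  obtain B where B: "B \<subseteq> wt \<mu>" "V.independent B" "wt \<mu> \<subseteq> V.span B"
    using V.maximal_independent_subset[of "wt \<mu>"] by blast
  have "finite B" using V.independent_span_bound[OF B0(1) B(2)] B(1) B0(2) by simp
  moreover have "V.span B = wt \<mu>"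
    using B(3) V.span_minimal[OF B(1) subspace_wt] by blast
  moreover have "B \<noteq> {}" using B(3) \<mu>(2,3) by auto
  ultimately show ?thesis using that B(2) by blast
qed

text \<open>Schur's lemma: a finite-dimensional weight space, preserved by the central operator,
  supplies an eigenvector, and the full eigenspace is a submodule.\<close>

lemma Z_scalar: "\<exists>c. \<forall>v. Z a b v = sV c v"
proof -
  obtain \<mu> B where B: "V.independent B" "finite B" "B \<noteq> {}" "V.span B = wt \<mu>"
    by (rule nonzero_weight_space)
  have Zwt: "Z a b ` wt \<mu> \<subseteq> wt \<mu>"
    by (auto simp: mem_wt T_def Z_central uce_rules mem_spaces V.endoD[OF endo_Z])
  obtain x where x: "x \<in> B" using B(3) by blast
  have "x \<noteq> 0" using x B(1) V.dependent_zero by blast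
  then have "\<not> wt \<mu> \<subseteq> {0}" using x B(4) V.span_base[of x B] by auto
  then obtain v c where v: "v \<noteq> 0" "V.shift (Z a b) c v = 0"
    using V.eigenvector_modulo[OF endo_Z B(2) subspace_wt _ Zwt V.subspace_single_0] B(4) by auto
  have "M.submodule {v. V.shift (Z a b) c v = 0}"
    unfolding M.submodule_def
  proof (intro conjI ballI)
    show "V.subspace {v. V.shift (Z a b) c v = 0}"
      using V.endo_subspace_vimage[OF V.endo_shift[OF endo_Z] V.subspace_single_0] by simp
    fix X u assume X: "X \<in> carr (uce_space sg sS)" and u: "u \<in> {v. V.shift (Z a b) c v = 0}"
    have "V.shift (Z a b) c (act X u) = act X (V.shift (Z a b) c u)"
      by (simp add: V.shift_def V.endoD[OF endo_act[OF X]] Z_central[OF X])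
    then show "act X u \<in> {v. V.shift (Z a b) c v = 0}"
      using u by (simp add: V.endoD[OF endo_act[OF X]])
  qed
  then have "{v. V.shift (Z a b) c v = 0} = UNIV"
    using M.submodules_trivial v by blast
  then show ?thesis by (auto simp: V.shift_def)
qed

text \<open>Under faithfulness it suffices to test on weight vectors, where \<open>H\<close> acts by
  known scalars.\<close>

lemma br_eq_zero_of_T:
  assumes K: "{x. \<forall>v. T x 1 v = 0} \<subseteq> {0}" and "\<And>\<mu> v. \<mu> \<in> dual_space sg H \<Longrightarrow> v \<in> wt \<mu> \<Longrightarrow> T x 1 v = 0"
  shows "x = 0"
  using K eq_zero_on_weight_spaces[OF endo_T, of x 1] assms(2) by blast

lemma Z_zero_of_faithful:
  assumes K: "{x. \<forall>v. T x 1 v = 0} \<subseteq> {0}"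
  shows "Z a b v = 0"
proof -
  have comm: "T x 1 (T y a v) = T y a (T x 1 v) + T (br x y) a v" for x y a v
    using T_commutator[of x 1 y a v] by (simp add: Z_one_left algebra_simps)
  have ab: "br h h' = 0" if h: "h \<in> H" "h' \<in> H" for h h'
  proof (rule br_eq_zero_of_T[OF K])
    fix \<mu> v assume "v \<in> wt \<mu>"
    then show "T (br h h') 1 v = 0"
      using comm[of h h' 1 v] h by (simp add: mem_wt V.endoD[OF endo_T] mult.commute)
  qed
  \<comment> \<open>\<open>T h 1\<close> minus its weight on \<open>v\<close> sends
    \<open>T y 1 v\<close> to \<open>T (br h y) 1 v\<close> and this to
    \<open>T (br h (br h y)) 1 v = 0\<close>, so semisimplicity on the module applies.\<close>
  have ss: "br h y = 0" if h: "h \<in> H" and 0: "br h (br h y) = 0" for h y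
  proof (rule br_eq_zero_of_T[OF K])
    fix \<mu> v assume v: "v \<in> wt \<mu>"
    let ?s = "V.shift (T h 1) (\<mu> h)"
    have "?s (T y 1 v) = T (br h y) 1 v"
      using comm[of h y 1 v] v h by (simp add: V.shift_def mem_wt V.endoD[OF endo_T])
    moreover have "?s (T (br h y) 1 v) = 0"
      using comm[of h "br h y" 1 v] v h by (simp add: V.shift_def mem_wt V.endoD[OF endo_T] 0 T_zero)
    ultimately show "T (br h y) 1 v = 0" using T_semisimple[OF h, of "\<mu> h" "T y 1 v"] by simp
  qed
  obtain h h' where h: "h \<in> H" "h' \<in> H" and K0: "g.killing h h' \<noteq> 0"
    using g.killing_nonzero_on_cartan[OF cartan ab ss] by blast
  obtain c where c: "\<And>v. Z a b v = sV c v" using Z_scalar by blast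
  obtain \<mu> B where B: "V.independent B" "finite B" "B \<noteq> {}" "V.span B = wt \<mu>"
    by (rule nonzero_weight_space)
  \<comment> \<open>\<open>H\<close> is abelian and \<open>Z 1 a = 0\<close>, so
    \<open>T h a\<close> commutes with the operators that define the weight space.\<close>
  have pres: "T h a ` B \<subseteq> V.span B" if "h \<in> H" for h a
  proof -
    have "T h a v \<in> wt \<mu>" if "v \<in> wt \<mu>" for v
      using that \<open>h \<in> H\<close> by (simp add: mem_wt comm ab T_zero V.endoD[OF endo_T])
    then show ?thesis using B(4) V.span_base by blast
  qed
  let ?P = "T h a" and ?Q = "T h' b" and ?r = "V.representation B"
  have PQ: "?P (?Q v) = ?Q (?P v) + sV (g.killing h h' * c) v" for v
    using T_commutator[of h a h' b v] by (simp add: ab[OF h] T_zero c algebra_simps)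
  have QP: "?Q (?P x) \<in> V.span B" if "x \<in> B" for x
  proof -
    have "?Q ` V.span B \<subseteq> V.span B"
      using pres[OF h(2)] V.endo_subspace_vimage[OF endo_T V.subspace_span, of h' b B]
        V.span_minimal[of B "{v. ?Q v \<in> V.span B}"] by blast
    then show ?thesis using pres[OF h(1)] that by blast
  qed
  have "V.trace_on B (\<lambda>v. ?P (?Q v)) = V.trace_on B (\<lambda>v. ?Q (?P v))"
    using V.trace_on_comm[OF B(2,1,2,1) endo_T pres[OF h(2)] endo_T pres[OF h(1)]] .
  moreover have "V.trace_on B (\<lambda>v. ?P (?Q v)) =
      V.trace_on B (\<lambda>v. ?Q (?P v)) + of_nat (card B) * (g.killing h h' * c)"
  proof -
    have "?r (?P (?Q x)) x = ?r (?Q (?P x)) x + g.killing h h' * c" if "x \<in> B" for x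
      using QP[OF that] V.span_base[OF that] V.representation_basis[OF B(1) that]
      by (simp add: PQ V.representation_add[OF B(1)] V.representation_scale[OF B(1)] V.span_scale)
    then show ?thesis by (simp add: V.trace_on_def sum.distrib)
  qed
  \<comment> \<open>In characteristic zero the dimension \<open>card B\<close> of a nonzero weight
    space is nonzero as a scalar.\<close>
  ultimately have "c = 0" using K0 B(2,3) by simp
  then show ?thesis using c by simp
qed

text \<open>The commutator of \<open>T x 1\<close> and \<open>T y a\<close> is
  \<open>T (br x y) a\<close>, so perfectness makes every \<open>T x a\<close> zero; only the
  central term of the general commutator then remains.\<close>

lemma Z_zero_of_trivial:
  assumes K: "\<And>x v. T x 1 v = 0"
  shows "Z a b v = 0"
proof -
  have "T (br x y) a v = 0" for x y a v
    using T_commutator[of x 1 y a v] by (simp add: Z_one_left K V.endoD[OF endo_T])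
  moreover have "g.subspace {x. T x a v = 0}" for a v
    by (rule g.subspaceI) (simp_all add: T_zero T_add T_scale)
  ultimately have T0: "T x a v = 0" for x a v
    using g.perfect_induct[of "{x. T x a v = 0}" x] by simp
  obtain x y where "g.killing x y \<noteq> 0" using g.killing_nonzero[OF cartan] by blast
  then show ?thesis using T_commutator[of x a y b v] by (simp add: T0)
qed

lemma Z_zero: "Z a b v = 0"
proof -
  let ?K = "{x. \<forall>v. T x 1 v = 0}"
  have "g.lie_ideal ?K"
    unfolding g.lie_ideal_def
  proof (intro conjI allI ballI)
    show "g.subspace ?K" by (rule g.subspaceI) (simp_all add: T_zero T_add T_scale)
    fix x y assume "y \<in> ?K"
    then have "T (br x y) 1 v = 0" for v
      using T_commutator[of x 1 y 1 v] by (simp add: Z_one_left V.endoD[OF endo_T])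
    then show "br x y \<in> ?K" by simp
  qed
  then consider "?K = {0}" | "?K = UNIV" using g.ideals_trivial by blast
  then show ?thesis
  proof cases
    case 1
    then show ?thesis using Z_zero_of_faithful by simp
  next
    case 2
    then show ?thesis using Z_zero_of_trivial by blast
  qed
qed

end

theorem theorem2p2:
  fixes sg :: "'k::{alg_closed_field, field_char_0} \<Rightarrow> 'g::ab_group_add \<Rightarrow> 'g"
    and br :: "'g \<Rightarrow> 'g \<Rightarrow> 'g"
    and H :: "'g set"
    and sS :: "'k \<Rightarrow> 's::{comm_ring, comm_monoid_mult} \<Rightarrow> 's"
    and sV :: "'k \<Rightarrow> 'v::ab_group_add \<Rightarrow> 'v"
    and act :: "('k, 'g, 's) uce \<Rightarrow> 'v \<Rightarrow> 'v"
  assumes "fin_dim_simple_lie_algebra sg br"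
    and "lie_algebra.cartan_subalgebra sg br H"
    and "fin_type_comm_algebra sS"
    and "simple_lie_module sV (uce_space sg sS) (uce_bracket sg br sS) act"
    and "uce_weight_module sg sS sV act H"
  shows "\<forall>r s v. act (vzero (tensor_space sg sS), central_symbol sS r s) v = 0"
proof -
  interpret g: fin_dim_simple_lie_algebra sg br by fact
  interpret S: fin_type_comm_algebra sS by fact
  interpret M: simple_lie_module sV "uce_space sg sS" "uce_bracket sg br sS" act by fact
  interpret uce_simple_weight_module sg br sS sV act H
    by unfold_locales (use assms(2,5) in auto)
  show ?thesis using Z_zero by (simp add: Z_def)
qed

end
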